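(* Let $\varepsilon>0$, and let $g_\varepsilon$, $M(\varepsilon)$ and $\delta_*(\varepsilon)$ be as described in the context. Let $x(\cdot)\in \mathbf{X}_{p,r}$ be a trajectory of system (E) generated by an admissible control function $u(\cdot)\in U_{q,r}$ with $\|u(\cdot)\|_q=r_0<r$. Let $\Omega_*\subset\Omega$ be a Lebesgue measurable set, let $u_*(\cdot):\Omega_*\to\mathbb{R}^m$ be a Lebesgue measurable function, and let $$v(\xi)=\begin{cases}u(\xi) & \text{if } \xi\in\Omega\setminus\Omega_*,\\ u_*(\xi) & \text{if } \xi\in\Omega_*,\end{cases}$$ be such that $\|v(\cdot)\|_q=r$. Let $z(\cdot)\in\mathbf{X}_{p,r}$ be the trajectory of system (E) generated by the admissible control function $v(\cdot)\in U_{q,r}$. If $$\mu(\Omega_* )\le \delta_*(\varepsilon),$$ then $$\|x(\cdot)-z(\cdot)\|_p\le \varepsilon .$$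
   Context: Setting. Let $k,n,m$ be positive integers, $\Omega\subset\mathbb{R}^k$ a compact set, $\mu$ Lebesgue measure, $\lambda\ge 0$, $r>0$, $q\in(1,\infty)$ and $p\in(1,\infty)$ with $\frac1p+\frac1q=1$. $\|\cdot\|$ is the Euclidean norm, $\|\cdot\|_p,\|\cdot\|_q,\|\cdot\|_\infty$ are the usual Lebesgue space norms. The system is the Urysohn type integral equation $$\text{(E)}\qquad x(\xi)=f(\xi,x(\xi))+\lambda\int_\Omega\left[K_1(\xi,s,x(s))+K_2(\xi,s,x(s))u(s)\right]ds,$$ where $f:\Omega\times\mathbb{R}^n\to\mathbb{R}^n$, $K_1:\Omega\times\Omega\times\mathbb{R}^n\to\mathbb{R}^n$, $K_2:\Omega\times\Omega\times\mathbb{R}^n\to\mathbb{R}^{n\times m}$. The following conditions are assumed. (A) $f(\cdot,x)$ is Lebesgue measurable for every fixed $x\in\mathbb{R}^n$, $f(\cdot,0)\in L_p(\Omega;\mathbb{R}^n)$, and there is $\gamma_0\in L_\infty(\Omega;[0,\infty))$ such that for a.a. $\xi\in\Omega$: $\|f(\xi,x_1)-f(\xi,x_2)\|\le\gamma_0(\xi)\|x_1-x_2\|$ for all $x_1,x_2\in\mathbb{R}^n$. (B) $K_1(\cdot,\cdot,x)$ is Lebesgue measurable for every fixed $x$, $K_1(\cdot,\cdot,0)\in L_p(\Omega\times\Omega;\mathbb{R}^n)$, and there is $\gamma_1:\Omega\times\Omega\to[0,\infty)$ for which the integral $\int_\Omega\left(\int_\Omega\gamma_1(\xi,s)^q\,ds\right)^{p/q}d\xi$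 is defined and finite, such that for a.a. $(\xi,s)\in\Omega\times\Omega$: $\|K_1(\xi,s,x_1)-K_1(\xi,s,x_2)\|\le\gamma_1(\xi,s)\|x_1-x_2\|$ for all $x_1,x_2\in\mathbb{R}^n$. (C) $K_2(\cdot,\cdot,x)$ is Lebesgue measurable for every fixed $x$, $K_2(\cdot,\cdot,0)\in L_p(\Omega\times\Omega;\mathbb{R}^{n\times m})$, and there is $\gamma_2\in L_\infty(\Omega\times\Omega;[0,\infty))$ such that for a.a. $(\xi,s)\in\Omega\times\Omega$: $\|K_2(\xi,s,x_1)-K_2(\xi,s,x_2)\|\le\gamma_2(\xi,s)\|x_1-x_2\|$ for all $x_1,x_2\in\mathbb{R}^n$. (D) With $\kappa_0=\|\gamma_0\|_\infty$, $\kappa_1=\left(\int_\Omega\left(\int_\Omega\gamma_1(\xi,s)^q\,ds\right)^{p/q}d\xi\right)^{1/p}$, $\kappa_2=\|\gamma_2\|_\infty$, the number $$L_*(\lambda)=6^{p-1}\left[\kappa_0^p+\lambda^p\kappa_1^p+\lambda^pr^p\kappa_2^p\mu(\Omega)\right]$$ satisfies $L_*(\lambda)<1$. Controls and trajectories. $U_{q,r}=\{u\in L_q(\Omega;\mathbb{R}^m):\|u\|_q\le r\}$ is the set of admissible control functions. A function $x\in L_p(\Omega;\mathbb{R}^n)$ satisfying (E) for a.a. $\xi\in\Omega$ is a trajectory of (E) generated by $u\in U_{q,r}$ (under (A)–(D) each $u\in U_{q,r}$ generates exactly one trajectory). $\mathbf{X}_{p,r}\subset L_p(\Omega;\mathbb{R}^n)$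 is the set of all trajectories generated by all $u\in U_{q,r}$. Constants. Let $c_*=2\lambda r\left[\frac{6^{p-1}}{1-L_*(\lambda)}\right]^{1/p}$. For $\varepsilon>0$ let $g_\varepsilon:\Omega\times\Omega\to\mathbb{R}^{n\times m}$ be a fixed continuous function with $$\int_\Omega\int_\Omega\|K_2(\xi,s,0)-g_\varepsilon(\xi,s)\|^p\,ds\,d\xi\le\frac{\varepsilon^p}{3c_*^p},$$ and let $M(\varepsilon)=\max\{\|g_\varepsilon(\xi,s)\|:(\xi,s)\in\Omega\times\Omega\}$. The number $\delta_*(\varepsilon)$ is any number in $\left(0,\frac{\varepsilon^p}{3M(\varepsilon)^pc_*^p\mu(\Omega)}\right)$ with the property that for every Lebesgue measurable set $E\subset\Omega$ with $\mu(E)\le\delta_*(\varepsilon)$ and every $y(\cdot)\in\mathbf{X}_{p,r}$, $$\int_E\|y(s)\|^p\,ds\le\frac{\varepsilon^p}{3\kappa_2^pc_*^p\mu(\Omega)}.$$ Convention: a quotient of a positive number by $0$ is read as $+\infty$. *)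

theory Defs
  imports "HOL-Analysis.Analysis" "HOL-Probability.Essential_Supremum"
begin

text \<open>Elements of Lebesgue spaces are represented by functions, not by equivalence classes; such
  functions are total, but only their values on \<open>S\<close> matter.\<close>

definition Lp_space :: "real \<Rightarrow> 'a::euclidean_space set \<Rightarrow> ('a \<Rightarrow> 'b::euclidean_space) set" where
  "Lp_space p S = {f. f \<in> borel_measurable (lebesgue_on S)
                    \<and> integrable (lebesgue_on S) (\<lambda>t. norm (f t) powr p)}"

definition Lp_norm :: "real \<Rightarrow> 'a::euclidean_space set \<Rightarrow> ('a \<Rightarrow> 'b::euclidean_space) \<Rightarrow> real" where
  "Lp_norm p S f = (\<integral>t. norm (f t) powr p \<partial>lebesgue_on S) powr (1 / p)"

text \<open>The essential supremum is taken in \<^typ>\<open>ennreal\<close>, so that it is \<open>0\<close> on a null set.\<close>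

definition Linf_space :: "'a::euclidean_space set \<Rightarrow> ('a \<Rightarrow> 'b::euclidean_space) set" where
  "Linf_space S = {f. f \<in> borel_measurable (lebesgue_on S)
                    \<and> esssup (lebesgue_on S) (\<lambda>t. ennreal (norm (f t))) < \<infinity>}"

definition Linf_norm :: "'a::euclidean_space set \<Rightarrow> ('a \<Rightarrow> 'b::euclidean_space) \<Rightarrow> real" where
  "Linf_norm S f = enn2real (esssup (lebesgue_on S) (\<lambda>t. ennreal (norm (f t))))"

text \<open>The three hypotheses on the right-hand side of the equation. The norm of
  \<^typ>\<open>real^'m^'n\<close> is the Euclidean norm of the \<open>n \<times> m\<close> matrix entries.\<close>

definition cond_A ::
  "(real^'k) set \<Rightarrow> real \<Rightarrow> (real^'k \<Rightarrow> real^'n \<Rightarrow> real^'n) \<Rightarrow> (real^'k \<Rightarrow> real) \<Rightarrow> bool" where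
  "cond_A \<Omega> p f \<gamma>0 \<longleftrightarrow>
     (\<forall>x. (\<lambda>\<xi>. f \<xi> x) \<in> borel_measurable (lebesgue_on \<Omega>)) \<and>
     (\<lambda>\<xi>. f \<xi> 0) \<in> Lp_space p \<Omega> \<and>
     \<gamma>0 \<in> Linf_space \<Omega> \<and> (\<forall>\<xi>\<in>\<Omega>. 0 \<le> \<gamma>0 \<xi>) \<and>
     (AE \<xi> in lebesgue_on \<Omega>. \<forall>x1 x2. norm (f \<xi> x1 - f \<xi> x2) \<le> \<gamma>0 \<xi> * norm (x1 - x2))"

text \<open>For \<open>\<gamma>1\<close> only existence and finiteness of the iterated integral is required: the inner
  integral has to be finite for almost all \<open>\<xi>\<close>, and its power \<open>p / q\<close> has to be integrable.\<close>

definition cond_B ::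
  "(real^'k) set \<Rightarrow> real \<Rightarrow> real \<Rightarrow> (real^'k \<Rightarrow> real^'k \<Rightarrow> real^'n \<Rightarrow> real^'n) \<Rightarrow>
    (real^'k \<Rightarrow> real^'k \<Rightarrow> real) \<Rightarrow> bool" where
  "cond_B \<Omega> p q K1 \<gamma>1 \<longleftrightarrow>
     (\<forall>x. (\<lambda>(\<xi>, s). K1 \<xi> s x) \<in> borel_measurable (lebesgue_on (\<Omega> \<times> \<Omega>))) \<and>
     (\<lambda>(\<xi>, s). K1 \<xi> s 0) \<in> Lp_space p (\<Omega> \<times> \<Omega>) \<and>
     (\<forall>\<xi>\<in>\<Omega>. \<forall>s\<in>\<Omega>. 0 \<le> \<gamma>1 \<xi> s) \<and>
     (AE \<xi> in lebesgue_on \<Omega>. integrable (lebesgue_on \<Omega>) (\<lambda>s. \<gamma>1 \<xi> s powr q)) \<and>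
     integrable (lebesgue_on \<Omega>) (\<lambda>\<xi>. (\<integral>s. \<gamma>1 \<xi> s powr q \<partial>lebesgue_on \<Omega>) powr (p / q)) \<and>
     (AE (\<xi>, s) in lebesgue_on (\<Omega> \<times> \<Omega>).
        \<forall>x1 x2. norm (K1 \<xi> s x1 - K1 \<xi> s x2) \<le> \<gamma>1 \<xi> s * norm (x1 - x2))"

definition cond_C ::
  "(real^'k) set \<Rightarrow> real \<Rightarrow> (real^'k \<Rightarrow> real^'k \<Rightarrow> real^'n \<Rightarrow> real^'m^'n) \<Rightarrow>
    (real^'k \<Rightarrow> real^'k \<Rightarrow> real) \<Rightarrow> bool" where
  "cond_C \<Omega> p K2 \<gamma>2 \<longleftrightarrow>
     (\<forall>x. (\<lambda>(\<xi>, s). K2 \<xi> s x) \<in> borel_measurable (lebesgue_on (\<Omega> \<times> \<Omega>))) \<and>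
     (\<lambda>(\<xi>, s). K2 \<xi> s 0) \<in> Lp_space p (\<Omega> \<times> \<Omega>) \<and>
     (\<lambda>(\<xi>, s). \<gamma>2 \<xi> s) \<in> Linf_space (\<Omega> \<times> \<Omega>) \<and> (\<forall>\<xi>\<in>\<Omega>. \<forall>s\<in>\<Omega>. 0 \<le> \<gamma>2 \<xi> s) \<and>
     (AE (\<xi>, s) in lebesgue_on (\<Omega> \<times> \<Omega>).
        \<forall>x1 x2. norm (K2 \<xi> s x1 - K2 \<xi> s x2) \<le> \<gamma>2 \<xi> s * norm (x1 - x2))"

definition kappa0 :: "(real^'k) set \<Rightarrow> (real^'k \<Rightarrow> real) \<Rightarrow> real" where
  "kappa0 \<Omega> \<gamma>0 = Linf_norm \<Omega> \<gamma>0"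

definition kappa1 ::
  "(real^'k) set \<Rightarrow> real \<Rightarrow> real \<Rightarrow> (real^'k \<Rightarrow> real^'k \<Rightarrow> real) \<Rightarrow> real" where
  "kappa1 \<Omega> p q \<gamma>1 =
     (\<integral>\<xi>. (\<integral>s. \<gamma>1 \<xi> s powr q \<partial>lebesgue_on \<Omega>) powr (p / q) \<partial>lebesgue_on \<Omega>) powr (1 / p)"

definition kappa2 :: "(real^'k) set \<Rightarrow> (real^'k \<Rightarrow> real^'k \<Rightarrow> real) \<Rightarrow> real" where
  "kappa2 \<Omega> \<gamma>2 = Linf_norm (\<Omega> \<times> \<Omega>) (\<lambda>(\<xi>, s). \<gamma>2 \<xi> s)"

definition L_star ::
  "(real^'k) set \<Rightarrow> real \<Rightarrow> real \<Rightarrow> real \<Rightarrow> (real^'k \<Rightarrow> real) \<Rightarrow>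
    (real^'k \<Rightarrow> real^'k \<Rightarrow> real) \<Rightarrow> (real^'k \<Rightarrow> real^'k \<Rightarrow> real) \<Rightarrow> real \<Rightarrow> real" where
  "L_star \<Omega> p q r \<gamma>0 \<gamma>1 \<gamma>2 lam =
     6 powr (p - 1) * (kappa0 \<Omega> \<gamma>0 powr p + lam powr p * kappa1 \<Omega> p q \<gamma>1 powr p
                       + lam powr p * r powr p * kappa2 \<Omega> \<gamma>2 powr p * measure lebesgue \<Omega>)"

definition controls :: "(real^'k) set \<Rightarrow> real \<Rightarrow> real \<Rightarrow> (real^'k \<Rightarrow> real^'m) set" where
  "controls \<Omega> q r = {u \<in> Lp_space q \<Omega>. Lp_norm q \<Omega> u \<le> r}"

text \<open>Since the Bochner integral of a non-integrable function is \<open>0\<close>, existence of the integral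
  in the equation is required explicitly.\<close>

definition trajectory ::
  "(real^'k) set \<Rightarrow> real \<Rightarrow> (real^'k \<Rightarrow> real^'n \<Rightarrow> real^'n) \<Rightarrow>
    (real^'k \<Rightarrow> real^'k \<Rightarrow> real^'n \<Rightarrow> real^'n) \<Rightarrow>
    (real^'k \<Rightarrow> real^'k \<Rightarrow> real^'n \<Rightarrow> real^'m^'n) \<Rightarrow> real \<Rightarrow>
    (real^'k \<Rightarrow> real^'m) \<Rightarrow> (real^'k \<Rightarrow> real^'n) \<Rightarrow> bool" where
  "trajectory \<Omega> p f K1 K2 lam u x \<longleftrightarrow>
     x \<in> Lp_space p \<Omega> \<and>
     (AE \<xi> in lebesgue_on \<Omega>.
        integrable (lebesgue_on \<Omega>) (\<lambda>s. K1 \<xi> s (x s) + K2 \<xi> s (x s) *v u s) \<and>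
        x \<xi> = f \<xi> (x \<xi>)
              + lam *\<^sub>R (\<integral>s. K1 \<xi> s (x s) + K2 \<xi> s (x s) *v u s \<partial>lebesgue_on \<Omega>))"

definition trajectories ::
  "(real^'k) set \<Rightarrow> real \<Rightarrow> real \<Rightarrow> real \<Rightarrow> (real^'k \<Rightarrow> real^'n \<Rightarrow> real^'n) \<Rightarrow>
    (real^'k \<Rightarrow> real^'k \<Rightarrow> real^'n \<Rightarrow> real^'n) \<Rightarrow>
    (real^'k \<Rightarrow> real^'k \<Rightarrow> real^'n \<Rightarrow> real^'m^'n) \<Rightarrow> real \<Rightarrow> (real^'k \<Rightarrow> real^'n) set" where
  "trajectories \<Omega> p q r f K1 K2 lam =
     {x. \<exists>u\<in>controls \<Omega> q r. trajectory \<Omega> p f K1 K2 lam u x}"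

definition c_star ::
  "(real^'k) set \<Rightarrow> real \<Rightarrow> real \<Rightarrow> real \<Rightarrow> (real^'k \<Rightarrow> real) \<Rightarrow>
    (real^'k \<Rightarrow> real^'k \<Rightarrow> real) \<Rightarrow> (real^'k \<Rightarrow> real^'k \<Rightarrow> real) \<Rightarrow> real \<Rightarrow> real" where
  "c_star \<Omega> p q r \<gamma>0 \<gamma>1 \<gamma>2 lam =
     2 * lam * r * (6 powr (p - 1) / (1 - L_star \<Omega> p q r \<gamma>0 \<gamma>1 \<gamma>2 lam)) powr (1 / p)"

text \<open>Quotients below are formed in \<^typ>\<open>ennreal\<close>, where a positive number divided by \<open>0\<close> is
  \<open>\<infinity>\<close>; in the applications any factor of the denominators may vanish.\<close>

definition kernel_approx ::
  "(real^'k) set \<Rightarrow> real \<Rightarrow> (real^'k \<Rightarrow> real^'k \<Rightarrow> real^'n \<Rightarrow> real^'m^'n) \<Rightarrow>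
    real \<Rightarrow> real \<Rightarrow> (real^'k \<Rightarrow> real^'k \<Rightarrow> real^'m^'n) \<Rightarrow> bool" where
  "kernel_approx \<Omega> p K2 c \<epsilon> g \<longleftrightarrow>
     continuous_on (\<Omega> \<times> \<Omega>) (\<lambda>(\<xi>, s). g \<xi> s) \<and>
     (\<integral>\<^sup>+\<xi>. (\<integral>\<^sup>+s. ennreal (norm (K2 \<xi> s 0 - g \<xi> s) powr p) \<partial>lebesgue_on \<Omega>) \<partial>lebesgue_on \<Omega>)
       \<le> ennreal (\<epsilon> powr p) / ennreal (3 * c powr p)"

text \<open>The supremum is a maximum when \<open>\<Omega>\<close> is compact and nonempty and \<open>g\<close> is continuous.\<close>

definition max_norm :: "(real^'k) set \<Rightarrow> (real^'k \<Rightarrow> real^'k \<Rightarrow> real^'m^'n) \<Rightarrow> real" where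
  "max_norm \<Omega> g = (SUP (\<xi>, s) \<in> \<Omega> \<times> \<Omega>. norm (g \<xi> s))"

text \<open>\<open>\<delta>\<close> is an admissible choice of \<open>\<delta>\<^sub>*(\<epsilon>)\<close>, given \<open>M = M(\<epsilon>)\<close>, \<open>\<kappa> = \<kappa>\<^sub>2\<close>, \<open>c = c\<^sub>*\<close> and
  the set \<open>X\<close> of all trajectories.\<close>

definition admissible_delta ::
  "(real^'k) set \<Rightarrow> real \<Rightarrow> (real^'k \<Rightarrow> real^'n) set \<Rightarrow> real \<Rightarrow> real \<Rightarrow> real \<Rightarrow> real \<Rightarrow> real \<Rightarrow> bool" where
  "admissible_delta \<Omega> p X \<kappa> c M \<epsilon> \<delta> \<longleftrightarrow>
     0 < \<delta> \<and>
     ennreal \<delta> < ennreal (\<epsilon> powr p) / ennreal (3 * M powr p * c powr p * measure lebesgue \<Omega>) \<and>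
     (\<forall>E\<in>sets lebesgue. E \<subseteq> \<Omega> \<longrightarrow> measure lebesgue E \<le> \<delta> \<longrightarrow>
        (\<forall>y\<in>X. (\<integral>\<^sup>+s. ennreal (norm (y s) powr p) \<partial>lebesgue_on E)
           \<le> ennreal (\<epsilon> powr p) / ennreal (3 * \<kappa> powr p * c powr p * measure lebesgue \<Omega>)))"

end

theory Submission
  imports Defs
begin

text \<open>
  Write \<open>w = norm (x - z)\<close> and let \<open>E\<close> be the small set on which the controls \<open>u\<close> and \<open>v\<close> may
  differ. Subtracting the equations of the two trajectories and using the Lipschitz conditions and
  the Hoelder inequality, one obtains for almost every \<open>\<xi>\<close> (\<open>trajectory_difference_pointwise\<close>)

  \<open>w(\<xi>) \<le> \<kappa>\<^sub>0 w(\<xi>) + \<lambda> (G(\<xi>) + \<kappa>\<^sub>2 r) \<parallel>w\<parallel> + 2 \<lambda> r (\<kappa>\<^sub>2 \<parallel>x\<parallel>\<^sub>E + H(\<xi>) + M \<mu>(E)\<^sup>1\<^sup>/\<^sup>p)\<close>,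

  where \<open>G(\<xi>)\<close> is the \<open>L\<^sub>q\<close> norm of \<open>\<gamma>\<^sub>1(\<xi>, \<cdot>)\<close>, \<open>H(\<xi>)\<close> the \<open>L\<^sub>p\<close> norm of
  \<open>K\<^sub>2(\<xi>, \<cdot>, 0) - g(\<xi>, \<cdot>)\<close>, and \<open>\<parallel>x\<parallel>\<^sub>E\<close> the \<open>L\<^sub>p\<close> norm of \<open>x\<close> over \<open>E\<close>. The last bracket comes from
  the term \<open>K\<^sub>2(\<xi>, s, x(s)) (u(s) - v(s))\<close>, which vanishes off \<open>E\<close>; there the matrix is bounded by
  \<open>\<kappa>\<^sub>2 norm (x(s))\<close>, by its distance to \<open>g\<close> at the state \<open>0\<close>, and by \<open>M\<close>, while \<open>u\<close> and \<open>v\<close>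
  contribute the factor \<open>2 r\<close>.

  The right-hand side has six terms. Taking powers with the power mean inequality (\<open>powr_sum_le\<close>)
  and integrating over \<open>\<Omega>\<close>, the three terms that contain \<open>w\<close> give \<open>L\<^sub>* \<parallel>w\<parallel>\<^sup>p\<close>, which is absorbed
  because \<open>L\<^sub>* < 1\<close> (\<open>trajectory_difference_integrated\<close>). The constant \<open>c\<^sub>*\<close> is made so that each of
  the other three contributes at most \<open>(1 - L\<^sub>*) \<epsilon>\<^sup>p / 3\<close>: the one with \<open>x\<close> and the one with \<open>M\<close> by the
  choice of \<open>\<delta>\<close>, the one with \<open>H\<close> by the choice of \<open>g\<close>.

  Measure theory enters where conditions on the product \<open>\<Omega> \<times> \<Omega>\<close> are used on its sections, through
  a passage to Borel functions and Tonelli's theorem (\<open>lebesgue_on_iterated_integral\<close>). The argument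
  needs \<open>\<lambda> > 0\<close> and \<open>\<mu>(\<Omega>) > 0\<close>, since smallness conditions become void otherwise; in the
  remaining cases \<open>x = z\<close> almost everywhere.
\<close>

section \<open>Power means and the Hoelder inequality\<close>

text \<open>The power mean inequality. Each summand is compared with the mean \<open>m\<close> of all of them: Young's
  inequality for \<open>a\<^sub>i * m powr (p - 1)\<close> says that the graph of \<open>t powr p\<close> lies above its
  tangent at \<open>m\<close>, and on summing over \<open>i\<close> the linear terms collapse. Unlike convexity of
  \<open>t powr p\<close> on the open half-line, this covers vanishing summands without a limit.\<close>

lemma powr_sum_le:
  fixes a :: "'i \<Rightarrow> real"
  assumes I: "finite I" and p: "p > 1" and a: "\<And>i. i \<in> I \<Longrightarrow> a i \<ge> 0"
  shows "(\<Sum>i\<in>I. a i) powr p \<le> real (card I) powr (p - 1) * (\<Sum>i\<in>I. a i powr p)"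
proof (cases "(\<Sum>i\<in>I. a i) = 0")
  case True
  then show ?thesis
    by (simp add: sum_nonneg)
next
  case False
  define S where "S = (\<Sum>i\<in>I. a i)"
  define n where "n = real (card I)"
  define m where "m = S / n"
  have "I \<noteq> {}"
    using False by auto
  then have n: "n > 0"
    using I by (simp add: n_def card_gt_0_iff)
  have S: "S > 0"
    using False a unfolding S_def by (metis less_eq_real_def sum_nonneg)
  have m: "m > 0"
    using S n by (simp add: m_def)
  have conj: "1 / p + 1 / (p / (p - 1)) = 1"
    using p by (simp add: field_simps)
  have "a i * m powr (p - 1) \<le> a i powr p / p + m powr p * (1 - 1 / p)" if "i \<in> I" for i
  proof -
    have "a i * m powr (p - 1) \<le> a i powr p / p + (m powr (p - 1)) powr (p / (p - 1)) / (p / (p - 1))"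
      by (rule Youngs_inequality) (use p conj a[OF that] in \<open>auto simp: field_simps\<close>)
    moreover have "(p - 1) * (p / (p - 1)) = p" "\<And>t. t / (p / (p - 1)) = t * (1 - 1 / p)"
      using p by (auto simp: field_simps)
    ultimately show ?thesis
      by (simp only: powr_powr)
  qed
  then have "(\<Sum>i\<in>I. a i * m powr (p - 1)) \<le> (\<Sum>i\<in>I. a i powr p / p + m powr p * (1 - 1 / p))"
    by (rule sum_mono)
  then have "S * m powr (p - 1) \<le> (\<Sum>i\<in>I. a i powr p) / p + n * (m powr p * (1 - 1 / p))"
    by (simp add: S_def n_def sum.distrib sum_divide_distrib sum_distrib_right)
  moreover have "S * m powr (p - 1) = n * m powr p"
    using n m S by (simp add: m_def powr_diff)
  ultimately have "n * m powr p / p \<le> (\<Sum>i\<in>I. a i powr p) / p"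
    by (simp add: algebra_simps)
  then have "n * m powr p \<le> (\<Sum>i\<in>I. a i powr p)"
    using p by (simp add: divide_le_cancel)
  moreover have "S powr p = n powr (p - 1) * (n * m powr p)"
    using n S by (simp add: m_def powr_divide powr_diff)
  ultimately show ?thesis
    using n by (simp add: S_def n_def mult_left_mono)
qed

text \<open>After division by the two norms \<open>a\<close> and \<open>b\<close>, Young's inequality bounds the product pointwise by
  a function whose integral is \<open>1 / p + 1 / q = 1\<close>. If one of the norms vanishes there is nothing to
  divide by, but then the product vanishes almost everywhere.\<close>

lemma Holder_nonneg:
  fixes f g :: "'a \<Rightarrow> real"
  assumes pq: "p > 1" "q > 1" "1 / p + 1 / q = 1"
    and f: "f \<in> borel_measurable M" "AE x in M. f x \<ge> 0" "integrable M (\<lambda>x. f x powr p)"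
    and g: "g \<in> borel_measurable M" "AE x in M. g x \<ge> 0" "integrable M (\<lambda>x. g x powr q)"
  shows "integrable M (\<lambda>x. f x * g x)"
    and "(\<integral>x. f x * g x \<partial>M) \<le> (\<integral>x. f x powr p \<partial>M) powr (1 / p) * (\<integral>x. g x powr q \<partial>M) powr (1 / q)"
proof -
  define A where "A = (\<integral>x. f x powr p \<partial>M)"
  define B where "B = (\<integral>x. g x powr q \<partial>M)"
  have young: "AE x in M. norm (f x * g x) \<le> f x powr p / p + g x powr q / q"
    using f(2) g(2) by eventually_elim (use Youngs_inequality[OF pq] in auto)
  show int: "integrable M (\<lambda>x. f x * g x)"
    by (rule Bochner_Integration.integrable_bound[of _ "\<lambda>x. f x powr p / p + g x powr q / q"])
       (use f g young in \<open>auto elim: eventually_mono\<close>)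
  have A0: "A \<ge> 0" and B0: "B \<ge> 0"
    by (simp_all add: A_def B_def)
  show "(\<integral>x. f x * g x \<partial>M) \<le> A powr (1 / p) * B powr (1 / q)"
  proof (cases "A = 0 \<or> B = 0")
    case True
    have "AE x in M. f x * g x = 0"
    proof (cases "A = 0")
      case True
      then have "AE x in M. f x powr p = 0"
        using integral_nonneg_eq_0_iff_AE[OF f(3)] by (simp add: A_def)
      then show ?thesis
        by eventually_elim auto
    next
      case False
      then have "B = 0"
        using True by simp
      then have "AE x in M. g x powr q = 0"
        using integral_nonneg_eq_0_iff_AE[OF g(3)] by (simp add: B_def)
      then show ?thesis
        by eventually_elim auto
    qed
    then have "(\<integral>x. f x * g x \<partial>M) = 0"
      by (rule integral_eq_zero_AE)
    then show ?thesis
      by simp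
  next
    case False
    then have A: "A > 0" and B: "B > 0"
      using A0 B0 by auto
    define a where "a = A powr (1 / p)"
    define b where "b = B powr (1 / q)"
    have a: "a > 0" "a powr p = A" and b: "b > 0" "b powr q = B"
      using A B pq by (auto simp: a_def b_def powr_powr)
    have "AE x in M. f x * g x \<le> a * b * (f x powr p / (p * A) + g x powr q / (q * B))"
      using f(2) g(2)
    proof eventually_elim
      case (elim x)
      have "(f x / a) * (g x / b) \<le> (f x / a) powr p / p + (g x / b) powr q / q"
        using Youngs_inequality[OF pq, of "f x / a" "g x / b"] elim a b by simp
      also have "\<dots> = f x powr p / (p * A) + g x powr q / (q * B)"
        using elim a b by (simp add: powr_divide mult.commute)
      finally show ?case
        using a b by (simp add: field_simps)
    qed
    then have "(\<integral>x. f x * g x \<partial>M) \<le> (\<integral>x. a * b * (f x powr p / (p * A) + g x powr q / (q * B)) \<partial>M)"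
      by (intro integral_mono_AE int) (use f g in auto)
    also have "\<dots> = a * b * (A / (p * A) + B / (q * B))"
      using f(3) g(3) by (simp add: A_def B_def)
    also have "\<dots> = a * b"
      using A B pq by simp
    finally show ?thesis
      by (simp add: a_def b_def)
  qed
qed

text \<open>The instance that produces the factor \<open>6 powr (p - 1)\<close> of the contraction constant \<open>L\<^sub>*\<close>: the
  difference of two trajectories is estimated by exactly six terms.\<close>

lemma powr_le_six_terms:
  fixes w a1 a2 a3 a4 a5 a6 :: real
  assumes p: "p > 1" and w: "0 \<le> w" "w \<le> a1 + a2 + a3 + a4 + a5 + a6"
    and a: "a1 \<ge> 0" "a2 \<ge> 0" "a3 \<ge> 0" "a4 \<ge> 0" "a5 \<ge> 0" "a6 \<ge> 0"
  shows "w powr p \<le> 6 powr (p - 1) *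
    (a1 powr p + a2 powr p + a3 powr p + a4 powr p + a5 powr p + a6 powr p)"
proof -
  let ?a = "\<lambda>i. [a1, a2, a3, a4, a5, a6] ! i"
  have sum6: "(\<Sum>i<6. \<phi> i) = \<phi> 0 + \<phi> 1 + \<phi> 2 + \<phi> 3 + \<phi> 4 + \<phi> 5" for \<phi> :: "nat \<Rightarrow> real"
    by (simp add: eval_nat_numeral)
  have "w powr p \<le> (\<Sum>i<6. ?a i) powr p"
    unfolding sum6 using p w by (intro powr_mono2) auto
  also have "\<dots> \<le> real (card {..<6::nat}) powr (p - 1) * (\<Sum>i<6. ?a i powr p)"
    using a by (intro powr_sum_le p) (auto simp: less_Suc_eq eval_nat_numeral)
  finally show ?thesis
    unfolding sum6 by simp
qed

text \<open>The form used for controls: a control is known only through the bound \<open>r\<close> on its norm.\<close>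

lemma Holder_le:
  fixes f :: "'a \<Rightarrow> real" and u :: "'a \<Rightarrow> 'b::euclidean_space"
  assumes pq: "p > 1" "q > 1" "1 / p + 1 / q = 1"
    and f: "f \<in> borel_measurable M" "AE x in M. f x \<ge> 0" "integrable M (\<lambda>x. f x powr p)"
    and u: "u \<in> borel_measurable M" "integrable M (\<lambda>x. norm (u x) powr q)"
      "(\<integral>x. norm (u x) powr q \<partial>M) powr (1 / q) \<le> r"
  shows "integrable M (\<lambda>x. f x * norm (u x))"
    and "(\<integral>x. f x * norm (u x) \<partial>M) \<le> r * (\<integral>x. f x powr p \<partial>M) powr (1 / p)"
proof -
  have g: "(\<lambda>x. norm (u x)) \<in> borel_measurable M" "AE x in M. norm (u x) \<ge> 0"
    using u(1) by auto
  show "integrable M (\<lambda>x. f x * norm (u x))"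
    by (rule Holder_nonneg(1)[OF pq f g u(2)])
  have "(\<integral>x. f x * norm (u x) \<partial>M)
      \<le> (\<integral>x. f x powr p \<partial>M) powr (1 / p) * (\<integral>x. norm (u x) powr q \<partial>M) powr (1 / q)"
    by (rule Holder_nonneg(2)[OF pq f g u(2)])
  also have "\<dots> \<le> (\<integral>x. f x powr p \<partial>M) powr (1 / p) * r"
    using u(3) by (intro mult_left_mono) auto
  finally show "(\<integral>x. f x * norm (u x) \<partial>M) \<le> r * (\<integral>x. f x powr p \<partial>M) powr (1 / p)"
    by (simp add: mult.commute)
qed

section \<open>Lebesgue measure on a product\<close>

text \<open>Lebesgue measure on a product is the completion of a product measure, not a product measure
  itself, so Fubini's theorem does not apply to it directly. A null set, however, is contained in a
  Borel null set, and for Borel sets almost every section is null.\<close>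

lemma AE_lebesgue_on_sections:
  fixes A :: "'a::euclidean_space set" and B :: "'b::euclidean_space set"
  assumes [measurable]: "A \<in> sets borel" "B \<in> sets borel"
    and P: "AE y in lebesgue_on (A \<times> B). P y"
  shows "AE \<xi> in lebesgue_on A. AE s in lebesgue_on B. P (\<xi>, s)"
proof -
  have [measurable]: "A \<times> B \<in> sets borel"
    by (rule borel_Times[OF assms(1,2)])
  have "AE y in lborel. y \<in> A \<times> B \<longrightarrow> P y"
    using P by (simp add: AE_restrict_space_iff AE_completion_iff)
  then have "AE y in lborel \<Otimes>\<^sub>M lborel. y \<in> A \<times> B \<longrightarrow> P y"
    unfolding lborel_prod .
  then have "AE \<xi> in lborel. AE s in lborel. (\<xi>, s) \<in> A \<times> B \<longrightarrow> P (\<xi>, s)"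
    by (rule lborel_pair.AE_pair)
  then have "AE \<xi> in lborel. \<xi> \<in> A \<longrightarrow> (AE s in lborel. s \<in> B \<longrightarrow> P (\<xi>, s))"
    by eventually_elim auto
  then show ?thesis
    by (simp add: AE_restrict_space_iff AE_completion_iff)
qed

text \<open>This lets a Lebesgue measurable function on a product be replaced by a Borel function, to which
  Tonelli's theorem does apply, at the price of null sets of sections and of points in them.\<close>

lemma lebesgue_on_Times_borel_sections:
  fixes A :: "'a::euclidean_space set" and B :: "'b::euclidean_space set"
    and F :: "'a \<times> 'b \<Rightarrow> real"
  assumes [measurable]: "A \<in> sets borel" "B \<in> sets borel"
    and F: "F \<in> borel_measurable (lebesgue_on (A \<times> B))"
  obtains h where "h \<in> borel_measurable (borel \<Otimes>\<^sub>M borel)"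
    and "AE \<xi> in lebesgue_on A. AE s in lebesgue_on B. F (\<xi>, s) = h (\<xi>, s)"
proof -
  have AB[measurable]: "A \<times> B \<in> sets borel"
    by (rule borel_Times[OF assms(1,2)])
  have "(\<lambda>y. indicator (A \<times> B) y *\<^sub>R F y) \<in> borel_measurable lebesgue"
    using F by (subst (asm) borel_measurable_restrict_space_iff) auto
  then obtain h where h: "h \<in> borel_measurable lborel"
      "AE y in lborel. indicator (A \<times> B) y *\<^sub>R F y = h y"
    using completion_ex_borel_measurable_real by blast
  have "AE y in lebesgue_on (A \<times> B). F y = h y"
    using h(2) by (auto simp: AE_restrict_space_iff AE_completion_iff indicator_def elim!: eventually_mono)
  from AE_lebesgue_on_sections[OF assms(1,2) this] h(1) show ?thesis
    by (intro that[of h]) (simp_all add: borel_prod)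
qed

lemma borel_measurable_lebesgue_on_AE:
  fixes f g :: "'a::euclidean_space \<Rightarrow> real"
  assumes S: "S \<in> sets lebesgue" and f: "f \<in> borel_measurable (lebesgue_on S)"
    and eq: "AE x in lebesgue_on S. f x = g x"
  shows "g \<in> borel_measurable (lebesgue_on S)"
proof -
  have "(\<lambda>x. indicator S x *\<^sub>R f x) \<in> borel_measurable lebesgue"
    using f S by (subst (asm) borel_measurable_restrict_space_iff) auto
  moreover have "AE x in lebesgue. indicator S x *\<^sub>R f x = indicator S x *\<^sub>R g x"
    using eq S by (auto simp: AE_restrict_space_iff indicator_def elim!: eventually_mono)
  ultimately have "(\<lambda>x. indicator S x *\<^sub>R g x) \<in> borel_measurable lebesgue"
    by (rule borel_measurable_AE)
  then show ?thesis
    using S by (subst borel_measurable_restrict_space_iff) auto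
qed

text \<open>Tonelli's theorem for a Lebesgue measurable kernel, in the form that turns a bound on the
  iterated integral in \<^typ>\<open>ennreal\<close> into statements about real integrals. The Borel
  representative \<open>h\<close> makes the inner integral a Borel function of \<open>\<xi>\<close>; since Lebesgue measure is
  complete, measurability carries over from \<open>h\<close> to the sections of \<open>F\<close> and to the inner integral
  of \<open>F\<close>, which agree with those of \<open>h\<close> almost everywhere.\<close>

lemma lebesgue_on_iterated_integral:
  fixes A :: "'a::euclidean_space set" and B :: "'b::euclidean_space set"
    and F :: "'a \<Rightarrow> 'b \<Rightarrow> real"
  assumes AB[measurable]: "A \<in> sets borel" "B \<in> sets borel"
    and F: "(\<lambda>(\<xi>, s). F \<xi> s) \<in> borel_measurable (lebesgue_on (A \<times> B))"
    and F0: "\<And>\<xi> s. F \<xi> s \<ge> 0"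
    and C: "(\<integral>\<^sup>+\<xi>. (\<integral>\<^sup>+s. ennreal (F \<xi> s) \<partial>lebesgue_on B) \<partial>lebesgue_on A) \<le> ennreal C" "C \<ge> 0"
  shows "AE \<xi> in lebesgue_on A. integrable (lebesgue_on B) (F \<xi>)"
    and "integrable (lebesgue_on A) (\<lambda>\<xi>. \<integral>s. F \<xi> s \<partial>lebesgue_on B)"
    and "(\<integral>\<xi>. (\<integral>s. F \<xi> s \<partial>lebesgue_on B) \<partial>lebesgue_on A) \<le> C"
proof -
  obtain h where h[measurable]: "h \<in> borel_measurable (borel \<Otimes>\<^sub>M borel)"
    and "AE \<xi> in lebesgue_on A. AE s in lebesgue_on B. (case (\<xi>, s) of (\<xi>, s) \<Rightarrow> F \<xi> s) = h (\<xi>, s)"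
    using lebesgue_on_Times_borel_sections[OF AB F] .
  then have eq: "AE \<xi> in lebesgue_on A. AE s in lebesgue_on B. F \<xi> s = h (\<xi>, s)"
    by simp
  have lb[simp]: "A \<in> sets lebesgue" "B \<in> sets lebesgue"
    using AB by auto
  define H where "H \<xi> = (\<integral>\<^sup>+s. ennreal (h (\<xi>, s)) * indicator B s \<partial>lborel)" for \<xi>
  have "H \<in> borel_measurable borel"
    unfolding H_def by measurable
  then have "H \<in> borel_measurable (completion lborel)"
    by (intro measurable_completion) simp
  then have H: "H \<in> borel_measurable (lebesgue_on A)"
    by (rule measurable_restrict_space1)
  have meas: "AE \<xi> in lebesgue_on A. F \<xi> \<in> borel_measurable (lebesgue_on B)"
    using eq
  proof eventually_elim
    case (elim \<xi>)
    have "(\<lambda>s. h (\<xi>, s)) \<in> borel_measurable borel"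
      by measurable
    then have "(\<lambda>s. h (\<xi>, s)) \<in> borel_measurable (completion lborel)"
      by (intro measurable_completion) simp
    then have "(\<lambda>s. h (\<xi>, s)) \<in> borel_measurable (lebesgue_on B)"
      by (rule measurable_restrict_space1)
    then show ?case
      by (rule borel_measurable_lebesgue_on_AE[rotated]) (use elim in \<open>auto elim: eventually_mono\<close>)
  qed
  have nnH: "AE \<xi> in lebesgue_on A. (\<integral>\<^sup>+s. ennreal (F \<xi> s) \<partial>lebesgue_on B) = H \<xi>"
    using eq
  proof eventually_elim
    case (elim \<xi>)
    then have "(\<integral>\<^sup>+s. ennreal (F \<xi> s) \<partial>lebesgue_on B) = (\<integral>\<^sup>+s. ennreal (h (\<xi>, s)) \<partial>lebesgue_on B)"
      by (intro nn_integral_cong_AE) (auto elim: eventually_mono)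
    then show ?case
      by (simp add: H_def nn_integral_restrict_space nn_integral_completion)
  qed
  have HC: "(\<integral>\<^sup>+\<xi>. H \<xi> \<partial>lebesgue_on A) \<le> ennreal C"
    using C(1) nn_integral_cong_AE[OF nnH] by simp
  then have "(\<integral>\<^sup>+\<xi>. H \<xi> \<partial>lebesgue_on A) \<noteq> \<infinity>"
    by (auto simp: top_unique)
  then have Hfin: "AE \<xi> in lebesgue_on A. H \<xi> \<noteq> \<infinity>"
    by (intro nn_integral_PInf_AE H)
  show int: "AE \<xi> in lebesgue_on A. integrable (lebesgue_on B) (F \<xi>)"
    using meas nnH Hfin
  proof eventually_elim
    case (elim \<xi>)
    then show ?case
      using F0 by (intro integrableI_nonneg) (auto simp: top.not_eq_extremum)
  qed
  define I where "I \<xi> = (\<integral>s. F \<xi> s \<partial>lebesgue_on B)" for \<xi>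
  have I: "AE \<xi> in lebesgue_on A. ennreal (I \<xi>) = H \<xi>"
    using int nnH
  proof eventually_elim
    case (elim \<xi>)
    then show ?case
      using F0 nn_integral_eq_integral[of "lebesgue_on B" "F \<xi>"] by (simp add: I_def)
  qed
  have I0: "I \<xi> \<ge> 0" for \<xi>
    unfolding I_def using F0 by (intro Bochner_Integration.integral_nonneg) auto
  have "(\<lambda>\<xi>. enn2real (H \<xi>)) \<in> borel_measurable (lebesgue_on A)"
    using H by measurable
  moreover have "AE \<xi> in lebesgue_on A. enn2real (H \<xi>) = I \<xi>"
    using I
  proof eventually_elim
    case (elim \<xi>)
    show ?case
      unfolding elim[symmetric] by (rule enn2real_ennreal[OF I0])
  qed
  ultimately have Im: "I \<in> borel_measurable (lebesgue_on A)"
    by (rule borel_measurable_lebesgue_on_AE[OF lb(1)])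
  have nnI: "(\<integral>\<^sup>+\<xi>. ennreal (I \<xi>) \<partial>lebesgue_on A) \<le> ennreal C"
    using HC nn_integral_cong_AE[OF I] by simp
  show I_int: "integrable (lebesgue_on A) I"
    using I0 le_less_trans[OF nnI ennreal_less_top] by (intro integrableI_nonneg Im) auto
  show "(\<integral>\<xi>. I \<xi> \<partial>lebesgue_on A) \<le> C"
    using nnI nn_integral_eq_integral[OF I_int] I0 C(2) by simp
qed

section \<open>Norms and Lipschitz constants\<close>

text \<open>The norm of a matrix is its Frobenius norm, so the row-wise Cauchy-Schwarz inequality suffices.\<close>

lemma norm_matrix_vector_le:
  fixes A :: "real^'m^'n" and x :: "real^'m"
  shows "norm (A *v x) \<le> norm A * norm x"
proof -
  have "norm (A *v x) = L2_set (\<lambda>i. \<bar>A $ i \<bullet> x\<bar>) UNIV"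
    by (simp add: norm_vec_def matrix_vector_mul_component)
  also have "\<dots> \<le> L2_set (\<lambda>i. norm (A $ i) * norm x) UNIV"
    by (intro L2_set_mono) (auto simp: Cauchy_Schwarz_ineq2)
  also have "\<dots> = norm A * norm x"
    by (simp add: L2_set_left_distrib norm_vec_def)
  finally show ?thesis .
qed

lemma Linf_norm_bound:
  assumes "f \<in> Linf_space S"
  shows "AE t in lebesgue_on S. norm (f t) \<le> Linf_norm S f"
proof -
  have fin: "esssup (lebesgue_on S) (\<lambda>t. ennreal (norm (f t))) < \<infinity>"
    using assms by (simp add: Linf_space_def)
  show ?thesis
    using esssup_AE[where M = "lebesgue_on S" and f = "\<lambda>t. ennreal (norm (f t))"]
  proof eventually_elim
    case (elim t)
    then show ?case
      using fin unfolding Linf_norm_def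
      by (metis enn2real_ennreal enn2real_mono infinity_ennreal_def norm_ge_zero)
  qed
qed

lemma Lp_space_diff:
  fixes x z :: "'a::euclidean_space \<Rightarrow> 'b::euclidean_space"
  assumes p: "p > 1" and x: "x \<in> Lp_space p S" and z: "z \<in> Lp_space p S"
  shows "(\<lambda>t. x t - z t) \<in> Lp_space p S"
proof -
  have [measurable]: "x \<in> borel_measurable (lebesgue_on S)" "z \<in> borel_measurable (lebesgue_on S)"
    using x z by (auto simp: Lp_space_def)
  have "norm (x t - z t) powr p \<le> 2 powr (p - 1) * (norm (x t) powr p + norm (z t) powr p)" for t
  proof -
    have "norm (x t - z t) powr p \<le> (norm (x t) + norm (z t)) powr p"
      using p by (intro powr_mono2 norm_triangle_ineq4) auto
    also have "\<dots> \<le> 2 powr (p - 1) * (norm (x t) powr p + norm (z t) powr p)"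
      using powr_sum_le[of "UNIV :: bool set" p "\<lambda>b. if b then norm (x t) else norm (z t)"] p
      by (simp add: UNIV_bool add.commute)
    finally show ?thesis .
  qed
  then have bound: "AE t in lebesgue_on S. norm (norm (x t - z t) powr p)
      \<le> norm (2 powr (p - 1) * (norm (x t) powr p + norm (z t) powr p))"
    by (intro AE_I2) simp
  have "integrable (lebesgue_on S) (\<lambda>t. 2 powr (p - 1) * (norm (x t) powr p + norm (z t) powr p))"
    using x z by (simp add: Lp_space_def)
  then have "integrable (lebesgue_on S) (\<lambda>t. norm (x t - z t) powr p)"
    by (rule Bochner_Integration.integrable_bound) (measurable, rule bound)
  then show ?thesis
    by (simp add: Lp_space_def)
qed

lemma Lp_norm_diff_eq_0:
  assumes "AE t in lebesgue_on S. x t = z t"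
  shows "Lp_norm p S (\<lambda>t. x t - z t) = 0"
proof -
  have "(\<integral>t. norm (x t - z t) powr p \<partial>lebesgue_on S) = 0"
    using assms by (intro integral_eq_zero_AE) (auto elim: eventually_mono)
  then show ?thesis
    by (simp add: Lp_norm_def)
qed

lemma norm_le_max_norm:
  fixes g :: "real^'k \<Rightarrow> real^'k \<Rightarrow> real^'m^'n"
  assumes "compact \<Omega>" "continuous_on (\<Omega> \<times> \<Omega>) (\<lambda>(\<xi>, s). g \<xi> s)" "\<xi> \<in> \<Omega>" "s \<in> \<Omega>"
  shows "norm (g \<xi> s) \<le> max_norm \<Omega> g"
proof -
  have "continuous_on (\<Omega> \<times> \<Omega>) (\<lambda>y. norm ((\<lambda>(\<xi>, s). g \<xi> s) y))"
    using assms(2) by (rule continuous_on_norm)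
  then have "compact ((\<lambda>y. norm ((\<lambda>(\<xi>, s). g \<xi> s) y)) ` (\<Omega> \<times> \<Omega>))"
    using assms(1) by (intro compact_continuous_image compact_Times)
  then have "bdd_above ((\<lambda>(\<xi>, s). norm (g \<xi> s)) ` (\<Omega> \<times> \<Omega>))"
    by (simp add: case_prod_beta' bounded_imp_bdd_above compact_imp_bounded)
  then have "(case (\<xi>, s) of (\<xi>, s) \<Rightarrow> norm (g \<xi> s)) \<le> max_norm \<Omega> g"
    unfolding max_norm_def using assms by (intro cSUP_upper) auto
  then show ?thesis
    by simp
qed

lemma cond_A_kappa0:
  assumes "cond_A \<Omega> p f \<gamma>0"
  shows "AE \<xi> in lebesgue_on \<Omega>. \<forall>y1 y2. norm (f \<xi> y1 - f \<xi> y2) \<le> kappa0 \<Omega> \<gamma>0 * norm (y1 - y2)"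
proof -
  have "\<gamma>0 \<in> Linf_space \<Omega>"
    using assms by (simp add: cond_A_def)
  then have "AE \<xi> in lebesgue_on \<Omega>. norm (\<gamma>0 \<xi>) \<le> kappa0 \<Omega> \<gamma>0"
    unfolding kappa0_def by (rule Linf_norm_bound)
  moreover have "AE \<xi> in lebesgue_on \<Omega>. \<forall>y1 y2. norm (f \<xi> y1 - f \<xi> y2) \<le> \<gamma>0 \<xi> * norm (y1 - y2)"
    using assms by (simp add: cond_A_def)
  ultimately show ?thesis
  proof eventually_elim
    case (elim \<xi>)
    then have "\<gamma>0 \<xi> \<le> kappa0 \<Omega> \<gamma>0"
      by simp
    with elim show ?case
      by (meson mult_right_mono norm_ge_zero order_trans)
  qed
qed

lemma cond_C_kappa2:
  assumes "cond_C \<Omega> p K2 \<gamma>2" and "\<Omega> \<in> sets borel"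
  shows "AE \<xi> in lebesgue_on \<Omega>. AE s in lebesgue_on \<Omega>.
    \<forall>y1 y2. norm (K2 \<xi> s y1 - K2 \<xi> s y2) \<le> kappa2 \<Omega> \<gamma>2 * norm (y1 - y2)"
proof -
  have "(\<lambda>(\<xi>, s). \<gamma>2 \<xi> s) \<in> Linf_space (\<Omega> \<times> \<Omega>)"
    using assms by (simp add: cond_C_def)
  then have "AE y in lebesgue_on (\<Omega> \<times> \<Omega>). norm (case y of (\<xi>, s) \<Rightarrow> \<gamma>2 \<xi> s) \<le> kappa2 \<Omega> \<gamma>2"
    unfolding kappa2_def by (rule Linf_norm_bound)
  moreover have "AE y in lebesgue_on (\<Omega> \<times> \<Omega>). case y of (\<xi>, s) \<Rightarrow>
      \<forall>y1 y2. norm (K2 \<xi> s y1 - K2 \<xi> s y2) \<le> \<gamma>2 \<xi> s * norm (y1 - y2)"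
    using assms by (simp add: cond_C_def)
  ultimately have "AE y in lebesgue_on (\<Omega> \<times> \<Omega>). case y of (\<xi>, s) \<Rightarrow>
      \<forall>y1 y2. norm (K2 \<xi> s y1 - K2 \<xi> s y2) \<le> kappa2 \<Omega> \<gamma>2 * norm (y1 - y2)"
  proof eventually_elim
    case (elim y)
    obtain \<xi> s where y: "y = (\<xi>, s)"
      by (cases y)
    have "\<gamma>2 \<xi> s \<le> kappa2 \<Omega> \<gamma>2"
      using elim by (simp add: y)
    with elim show ?case
      unfolding y prod.case by (meson mult_right_mono norm_ge_zero order_trans)
  qed
  then have "AE \<xi> in lebesgue_on \<Omega>. AE s in lebesgue_on \<Omega>. case (\<xi>, s) of (\<xi>, s) \<Rightarrow>
      \<forall>y1 y2. norm (K2 \<xi> s y1 - K2 \<xi> s y2) \<le> kappa2 \<Omega> \<gamma>2 * norm (y1 - y2)"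
    by (rule AE_lebesgue_on_sections[OF assms(2,2)])
  then show ?thesis
    by simp
qed

section \<open>Comparing two trajectories at one point\<close>

text \<open>The change of control and the change of state are separated: the matrix \<open>K\<^sub>2\<close> at the state \<open>x\<close> is
  applied to \<open>u - v\<close>, and the increment of \<open>K\<^sub>2\<close> is applied to \<open>v\<close>. The matrix at \<open>x\<close> is then
  compared with the one at the state \<open>0\<close>, where alone its size is known.\<close>

lemma urysohn_integrand_difference:
  fixes k1 :: "real^'n \<Rightarrow> real^'n" and k2 :: "real^'n \<Rightarrow> real^'m^'n"
  assumes "norm (k1 x - k1 z) \<le> c * norm (x - z)"
    and k2: "\<And>y1 y2. norm (k2 y1 - k2 y2) \<le> \<kappa> * norm (y1 - y2)"
    and k20: "norm (k2 0) \<le> h"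
  shows "norm ((k1 x + k2 x *v u) - (k1 z + k2 z *v v))
    \<le> c * norm (x - z) + \<kappa> * norm (x - z) * norm v + (\<kappa> * norm x + h) * norm (u - v)"
proof -
  have split: "(k1 x + k2 x *v u) - (k1 z + k2 z *v v)
      = (k1 x - k1 z) + (k2 x - k2 z) *v v + k2 x *v (u - v)"
    by (simp add: matrix_vector_mult_diff_distrib matrix_vector_mult_diff_rdistrib)
  have "norm (k2 x) \<le> \<kappa> * norm x + h"
    using k2[of x 0] k20 norm_triangle_ineq2[of "k2 x" "k2 0"] by simp
  then have "norm (k2 x *v (u - v)) \<le> (\<kappa> * norm x + h) * norm (u - v)"
    by (meson mult_right_mono norm_ge_zero norm_matrix_vector_le order_trans)
  moreover have "norm ((k2 x - k2 z) *v v) \<le> \<kappa> * norm (x - z) * norm v"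
    by (meson k2 mult_right_mono norm_ge_zero norm_matrix_vector_le order_trans)
  ultimately show ?thesis
    unfolding split using assms(1) by (intro norm_triangle_le add_mono) auto
qed

text \<open>Here \<open>\<xi>\<close> is fixed and \<open>N\<close> is the measure in \<open>s\<close>. Each term of the bound in
  \<open>urysohn_integrand_difference\<close> is integrated with the Hoelder inequality. The terms that carry
  \<open>u - v\<close> live on the set \<open>E\<close> where the controls differ; bounding \<open>norm (u - v)\<close> there by
  \<open>norm u + norm v\<close> and applying the Hoelder inequality to both summands gives the factor \<open>2 * r\<close>.
  The restriction to \<open>E\<close> is kept in the terms with \<open>x\<close> and with the constant \<open>B\<close>, which are small
  only because \<open>E\<close> is; the term with \<open>h\<close> is small by itself, and is integrated over the whole space.\<close>

lemma urysohn_integral_difference: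
  fixes k1 :: "'a \<Rightarrow> real^'n \<Rightarrow> real^'n" and k2 :: "'a \<Rightarrow> real^'n \<Rightarrow> real^'m^'n"
    and u v :: "'a \<Rightarrow> real^'m" and x z :: "'a \<Rightarrow> real^'n" and c h :: "'a \<Rightarrow> real"
  assumes pq: "p > 1" "q > 1" "1 / p + 1 / q = 1"
    and fin: "finite_measure N" and E[measurable]: "E \<in> sets N"
    and \<kappa>: "\<kappa> \<ge> 0" and B: "B \<ge> 0"
    and u: "u \<in> borel_measurable N" "integrable N (\<lambda>s. norm (u s) powr q)"
      "(\<integral>s. norm (u s) powr q \<partial>N) powr (1 / q) \<le> r"
    and v: "v \<in> borel_measurable N" "integrable N (\<lambda>s. norm (v s) powr q)"
      "(\<integral>s. norm (v s) powr q \<partial>N) powr (1 / q) \<le> r"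
    and uv: "\<And>s. s \<notin> E \<Longrightarrow> u s = v s"
    and x[measurable]: "x \<in> borel_measurable N" and z[measurable]: "z \<in> borel_measurable N"
    and xp: "integrable N (\<lambda>s. norm (x s) powr p)"
    and wp: "integrable N (\<lambda>s. norm (x s - z s) powr p)"
    and k1: "AE s in N. \<forall>y1 y2. norm (k1 s y1 - k1 s y2) \<le> c s * norm (y1 - y2)"
    and c: "c \<in> borel_measurable N" "AE s in N. c s \<ge> 0" "integrable N (\<lambda>s. c s powr q)"
    and k2: "AE s in N. \<forall>y1 y2. norm (k2 s y1 - k2 s y2) \<le> \<kappa> * norm (y1 - y2)"
    and k20: "AE s in N. norm (k2 s 0) \<le> h s + B"
    and h: "h \<in> borel_measurable N" "AE s in N. h s \<ge> 0" "integrable N (\<lambda>s. h s powr p)"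
    and intx: "integrable N (\<lambda>s. k1 s (x s) + k2 s (x s) *v u s)"
    and intz: "integrable N (\<lambda>s. k1 s (z s) + k2 s (z s) *v v s)"
  shows "norm ((\<integral>s. k1 s (x s) + k2 s (x s) *v u s \<partial>N) - (\<integral>s. k1 s (z s) + k2 s (z s) *v v s \<partial>N))
    \<le> (\<integral>s. c s powr q \<partial>N) powr (1 / q) * (\<integral>s. norm (x s - z s) powr p \<partial>N) powr (1 / p)
      + \<kappa> * r * (\<integral>s. norm (x s - z s) powr p \<partial>N) powr (1 / p)
      + 2 * r * (\<kappa> * (\<integral>s. indicator E s * norm (x s) powr p \<partial>N) powr (1 / p)
                + (\<integral>s. h s powr p \<partial>N) powr (1 / p) + B * measure N E powr (1 / p))"
proof -
  interpret finite_measure N by (rule fin)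
  define w where "w s = norm (x s - z s)" for s
  define e1 where "e1 s = indicator E s * norm (x s)" for s
  define e3 where "e3 s = (indicator E s :: real)" for s
  have wm[measurable]: "w \<in> borel_measurable N" and e1m: "e1 \<in> borel_measurable N"
    and e3m: "e3 \<in> borel_measurable N"
    unfolding w_def e1_def e3_def by measurable
  have e1p: "e1 s powr p = indicator E s * norm (x s) powr p" for s
    by (simp add: e1_def powr_mult indicator_def)
  have e3p: "e3 s powr p = indicator E s" for s
    by (simp add: e3_def indicator_def)
  have i1: "integrable N (\<lambda>s. e1 s powr p)"
    unfolding e1p using integrable_mult_indicator[OF E xp] by simp
  have i3: "integrable N (\<lambda>s. e3 s powr p)"
    unfolding e3p by (simp add: integrable_indicator_iff less_top[symmetric])
  have pw: "integrable N (\<lambda>s. w s powr p)"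
    using wp by (simp add: w_def)
  have nn: "AE s in N. w s \<ge> 0" "AE s in N. e1 s \<ge> 0" "AE s in N. e3 s \<ge> 0"
    by (auto simp: w_def e1_def e3_def)
  have qp: "1 / q + 1 / p = 1"
    using pq(3) by simp
  note cw = Holder_nonneg[OF pq(2,1) qp c wm nn(1) pw]
  note wv = Holder_le[OF pq wm nn(1) pw v]
  note e1u = Holder_le[OF pq e1m nn(2) i1 u] and e1v = Holder_le[OF pq e1m nn(2) i1 v]
  note e3u = Holder_le[OF pq e3m nn(3) i3 u] and e3v = Holder_le[OF pq e3m nn(3) i3 v]
  note hu = Holder_le[OF pq h u] and hv = Holder_le[OF pq h v]
  \<comment> \<open>Fully expanded, so that each summand is one product covered by the Hoelder inequality.\<close>
  let ?b = "\<lambda>s. c s * w s + \<kappa> * (w s * norm (v s))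
      + (\<kappa> * (e1 s * norm (u s)) + \<kappa> * (e1 s * norm (v s)) + h s * norm (u s) + h s * norm (v s)
        + B * (e3 s * norm (u s)) + B * (e3 s * norm (v s)))"
  have bint: "integrable N ?b"
    by (intro Bochner_Integration.integrable_add integrable_mult_right cw(1) wv(1) e1u(1) e1v(1) e3u(1) e3v(1) hu(1) hv(1))
  have bound: "AE s in N. norm ((k1 s (x s) + k2 s (x s) *v u s) - (k1 s (z s) + k2 s (z s) *v v s)) \<le> ?b s"
    using k1 k2 k20 h(2)
  proof eventually_elim
    case (elim s)
    have le: "norm ((k1 s (x s) + k2 s (x s) *v u s) - (k1 s (z s) + k2 s (z s) *v v s))
        \<le> c s * w s + \<kappa> * w s * norm (v s) + (\<kappa> * norm (x s) + (h s + B)) * norm (u s - v s)"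
      unfolding w_def by (rule urysohn_integrand_difference) (use elim in auto)
    have "(\<kappa> * norm (x s) + (h s + B)) * norm (u s - v s)
        \<le> (\<kappa> * e1 s + h s + B * e3 s) * (norm (u s) + norm (v s))"
    proof (cases "s \<in> E")
      case True
      then show ?thesis
        using elim \<kappa> B norm_triangle_ineq4[of "u s" "v s"]
        by (auto simp: e1_def e3_def add.assoc intro!: mult_left_mono add_nonneg_nonneg)
    next
      case False
      then show ?thesis
        using uv elim by (auto simp: e1_def e3_def)
    qed
    with le show ?case
      by (simp add: algebra_simps)
  qed
  have "norm ((\<integral>s. k1 s (x s) + k2 s (x s) *v u s \<partial>N) - (\<integral>s. k1 s (z s) + k2 s (z s) *v v s \<partial>N))
      = norm (\<integral>s. (k1 s (x s) + k2 s (x s) *v u s) - (k1 s (z s) + k2 s (z s) *v v s) \<partial>N)"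
    using intx intz by simp
  also have "\<dots> \<le> (\<integral>s. norm ((k1 s (x s) + k2 s (x s) *v u s) - (k1 s (z s) + k2 s (z s) *v v s)) \<partial>N)"
    by (rule integral_norm_bound)
  also have "\<dots> \<le> (\<integral>s. ?b s \<partial>N)"
    by (intro integral_mono_AE bint bound integrable_norm Bochner_Integration.integrable_diff intx intz)
  also have "\<dots> = (\<integral>s. c s * w s \<partial>N) + \<kappa> * (\<integral>s. w s * norm (v s) \<partial>N)
      + (\<kappa> * (\<integral>s. e1 s * norm (u s) \<partial>N) + \<kappa> * (\<integral>s. e1 s * norm (v s) \<partial>N)
        + (\<integral>s. h s * norm (u s) \<partial>N) + (\<integral>s. h s * norm (v s) \<partial>N)
        + B * (\<integral>s. e3 s * norm (u s) \<partial>N) + B * (\<integral>s. e3 s * norm (v s) \<partial>N))"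
    using cw(1) wv(1) e1u(1) e1v(1) e3u(1) e3v(1) hu(1) hv(1) by simp
  also have "\<dots> \<le> (\<integral>s. c s powr q \<partial>N) powr (1 / q) * (\<integral>s. w s powr p \<partial>N) powr (1 / p)
      + \<kappa> * (r * (\<integral>s. w s powr p \<partial>N) powr (1 / p))
      + (\<kappa> * (r * (\<integral>s. e1 s powr p \<partial>N) powr (1 / p)) + \<kappa> * (r * (\<integral>s. e1 s powr p \<partial>N) powr (1 / p))
        + r * (\<integral>s. h s powr p \<partial>N) powr (1 / p) + r * (\<integral>s. h s powr p \<partial>N) powr (1 / p)
        + B * (r * (\<integral>s. e3 s powr p \<partial>N) powr (1 / p)) + B * (r * (\<integral>s. e3 s powr p \<partial>N) powr (1 / p)))"
    by (intro add_mono mult_left_mono cw(2) wv(2) e1u(2) e1v(2) e3u(2) e3v(2) hu(2) hv(2) \<kappa> B)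
  finally show ?thesis
    using E by (simp add: e1p e3p w_def algebra_simps)
qed

text \<open>The equations of the two trajectories are subtracted. The kernel \<open>K\<^sub>2\<close> at the state \<open>0\<close> is split as
  \<open>g + (K\<^sub>2 - g)\<close> with \<open>g\<close> bounded by \<open>M\<close>. Measurability of \<open>\<gamma>\<^sub>1\<close> and of the norm of \<open>K\<^sub>2 - g\<close> in \<open>s\<close>
  is recovered from the integrability of their powers, by taking roots.\<close>

lemma trajectory_difference_pointwise:
  fixes \<Omega> E :: "(real^'k) set"
    and K2 :: "real^'k \<Rightarrow> real^'k \<Rightarrow> real^'n \<Rightarrow> real^'m^'n"
    and u v :: "real^'k \<Rightarrow> real^'m" and x z :: "real^'k \<Rightarrow> real^'n"
  assumes pq: "p > 1" "q > 1" "1 / p + 1 / q = 1" and lam: "lam \<ge> 0"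
    and \<Omega>: "compact \<Omega>" and E: "E \<in> sets lebesgue" "E \<subseteq> \<Omega>"
    and A: "cond_A \<Omega> p f \<gamma>0" and B: "cond_B \<Omega> p q K1 \<gamma>1" and C: "cond_C \<Omega> p K2 \<gamma>2"
    and u: "u \<in> controls \<Omega> q r" and v: "v \<in> controls \<Omega> q r"
    and uv: "\<And>s. s \<notin> E \<Longrightarrow> u s = v s"
    and x: "trajectory \<Omega> p f K1 K2 lam u x" and z: "trajectory \<Omega> p f K1 K2 lam v z"
    and M: "M \<ge> 0" "\<And>\<xi> s. \<xi> \<in> \<Omega> \<Longrightarrow> s \<in> \<Omega> \<Longrightarrow> norm (g \<xi> s) \<le> M"
    and gp: "AE \<xi> in lebesgue_on \<Omega>. integrable (lebesgue_on \<Omega>) (\<lambda>s. norm (K2 \<xi> s 0 - g \<xi> s) powr p)"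
  shows "AE \<xi> in lebesgue_on \<Omega>. norm (x \<xi> - z \<xi>) \<le> kappa0 \<Omega> \<gamma>0 * norm (x \<xi> - z \<xi>)
    + lam * ((\<integral>s. \<gamma>1 \<xi> s powr q \<partial>lebesgue_on \<Omega>) powr (1 / q) * Lp_norm p \<Omega> (\<lambda>s. x s - z s)
      + kappa2 \<Omega> \<gamma>2 * r * Lp_norm p \<Omega> (\<lambda>s. x s - z s)
      + 2 * r * (kappa2 \<Omega> \<gamma>2 * (\<integral>s. indicator E s * norm (x s) powr p \<partial>lebesgue_on \<Omega>) powr (1 / p)
          + (\<integral>s. norm (K2 \<xi> s 0 - g \<xi> s) powr p \<partial>lebesgue_on \<Omega>) powr (1 / p)
          + M * measure lebesgue E powr (1 / p)))"
proof -
  let ?N = "lebesgue_on \<Omega>"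
  have \<Omega>b: "\<Omega> \<in> sets borel"
    using \<Omega> by (simp add: borel_compact)
  then have \<Omega>l: "\<Omega> \<in> sets lebesgue"
    by simp
  have fin: "finite_measure ?N"
    using \<Omega> by (intro finite_measure_lebesgue_on lmeasurable_compact)
  have EN: "E \<in> sets ?N"
    using E \<Omega>l by (simp add: sets_restrict_space_iff)
  have mE: "measure ?N E = measure lebesgue E"
    using E \<Omega>l by (intro measure_restrict_space) auto
  have xL: "x \<in> Lp_space p \<Omega>" and zL: "z \<in> Lp_space p \<Omega>"
    using x z by (auto simp: trajectory_def)
  have xzL: "(\<lambda>s. x s - z s) \<in> Lp_space p \<Omega>"
    by (rule Lp_space_diff[OF pq(1) xL zL])
  have k1: "AE \<xi> in ?N. AE s in ?N. \<forall>y1 y2. norm (K1 \<xi> s y1 - K1 \<xi> s y2) \<le> \<gamma>1 \<xi> s * norm (y1 - y2)"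
    using AE_lebesgue_on_sections[OF \<Omega>b \<Omega>b, of "\<lambda>(\<xi>, s). \<forall>y1 y2. norm (K1 \<xi> s y1 - K1 \<xi> s y2) \<le> \<gamma>1 \<xi> s * norm (y1 - y2)"]
      B by (simp add: cond_B_def)
  have \<gamma>1: "AE \<xi> in ?N. integrable ?N (\<lambda>s. \<gamma>1 \<xi> s powr q)"
    using B by (simp add: cond_B_def)
  have tx: "AE \<xi> in ?N. integrable ?N (\<lambda>s. K1 \<xi> s (x s) + K2 \<xi> s (x s) *v u s) \<and>
      x \<xi> = f \<xi> (x \<xi>) + lam *\<^sub>R (\<integral>s. K1 \<xi> s (x s) + K2 \<xi> s (x s) *v u s \<partial>?N)"
    using x by (simp add: trajectory_def)
  have tz: "AE \<xi> in ?N. integrable ?N (\<lambda>s. K1 \<xi> s (z s) + K2 \<xi> s (z s) *v v s) \<and>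
      z \<xi> = f \<xi> (z \<xi>) + lam *\<^sub>R (\<integral>s. K1 \<xi> s (z s) + K2 \<xi> s (z s) *v v s \<partial>?N)"
    using z by (simp add: trajectory_def)
  show ?thesis
    using AE_space cond_A_kappa0[OF A] cond_C_kappa2[OF C \<Omega>b] k1 \<gamma>1 tx tz gp
  proof eventually_elim
    case (elim \<xi>)
    then have \<xi>: "\<xi> \<in> \<Omega>"
      by simp
    have "(\<lambda>s. (\<gamma>1 \<xi> s powr q) powr (1 / q)) \<in> borel_measurable ?N"
      using borel_measurable_integrable[OF elim(5)] by measurable
    moreover have "(\<gamma>1 \<xi> s powr q) powr (1 / q) = \<gamma>1 \<xi> s" if "s \<in> \<Omega>" for s
      using B \<xi> that pq by (simp add: cond_B_def powr_powr)
    ultimately have cm: "\<gamma>1 \<xi> \<in> borel_measurable ?N"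
      by (subst measurable_cong[where g = "\<lambda>s. (\<gamma>1 \<xi> s powr q) powr (1 / q)"]) auto
    have c0: "AE s in ?N. \<gamma>1 \<xi> s \<ge> 0"
      using B \<xi> by (intro AE_I2) (auto simp: cond_B_def)
    have "(\<lambda>s. (norm (K2 \<xi> s 0 - g \<xi> s) powr p) powr (1 / p)) \<in> borel_measurable ?N"
      using borel_measurable_integrable[OF elim(8)] by measurable
    then have hm: "(\<lambda>s. norm (K2 \<xi> s 0 - g \<xi> s)) \<in> borel_measurable ?N"
      using pq by (simp add: powr_powr)
    have k20: "AE s in ?N. norm (K2 \<xi> s 0) \<le> norm (K2 \<xi> s 0 - g \<xi> s) + M"
    proof (rule AE_I2)
      fix s assume "s \<in> space ?N"
      then show "norm (K2 \<xi> s 0) \<le> norm (K2 \<xi> s 0 - g \<xi> s) + M"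
        using M(2)[OF \<xi>, of s] norm_triangle_ineq2[of "K2 \<xi> s 0" "g \<xi> s"] by simp
    qed
    have \<kappa>: "kappa2 \<Omega> \<gamma>2 \<ge> 0"
      by (simp add: kappa2_def Linf_norm_def)
    let ?Ix = "\<integral>s. K1 \<xi> s (x s) + K2 \<xi> s (x s) *v u s \<partial>?N"
    let ?Iz = "\<integral>s. K1 \<xi> s (z s) + K2 \<xi> s (z s) *v v s \<partial>?N"
    let ?R = "(\<integral>s. \<gamma>1 \<xi> s powr q \<partial>?N) powr (1 / q) * Lp_norm p \<Omega> (\<lambda>s. x s - z s)
      + kappa2 \<Omega> \<gamma>2 * r * Lp_norm p \<Omega> (\<lambda>s. x s - z s)
      + 2 * r * (kappa2 \<Omega> \<gamma>2 * (\<integral>s. indicator E s * norm (x s) powr p \<partial>?N) powr (1 / p)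
          + (\<integral>s. norm (K2 \<xi> s 0 - g \<xi> s) powr p \<partial>?N) powr (1 / p)
          + M * measure lebesgue E powr (1 / p))"
    have "norm (?Ix - ?Iz) \<le> ?R"
      unfolding Lp_norm_def mE[symmetric]
    proof (rule urysohn_integral_difference[OF pq fin EN \<kappa> M(1)])
      show "AE s in ?N. norm (K2 \<xi> s 0 - g \<xi> s) \<ge> 0"
        by simp
    qed (use u v uv xL zL xzL elim cm c0 hm k20 in \<open>simp_all add: controls_def Lp_space_def Lp_norm_def\<close>)
    then have "norm (lam *\<^sub>R (?Ix - ?Iz)) \<le> lam * ?R"
      using lam by (simp add: mult_left_mono)
    with elim(2) have le: "norm (f \<xi> (x \<xi>) - f \<xi> (z \<xi>)) + norm (lam *\<^sub>R (?Ix - ?Iz))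
        \<le> kappa0 \<Omega> \<gamma>0 * norm (x \<xi> - z \<xi>) + lam * ?R"
      by (intro add_mono) simp_all
    have "a - b = (a' - b') + lam *\<^sub>R (I - J)" if "a = a' + lam *\<^sub>R I" "b = b' + lam *\<^sub>R J"
      for a b a' b' I J :: "real^'n"
      by (simp add: that scaleR_diff_right)
    then have "x \<xi> - z \<xi> = (f \<xi> (x \<xi>) - f \<xi> (z \<xi>)) + lam *\<^sub>R (?Ix - ?Iz)"
      using elim(6)[THEN conjunct2] elim(7)[THEN conjunct2] .
    then have "norm (x \<xi> - z \<xi>)
        \<le> norm (f \<xi> (x \<xi>) - f \<xi> (z \<xi>)) + norm (lam *\<^sub>R (?Ix - ?Iz))"
      by (rule ord_eq_le_trans[OF arg_cong[where f = norm] norm_triangle_ineq])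
    then show ?case
      using le by (rule order_trans)
  qed
qed

section \<open>Integrating the comparison\<close>

text \<open>The pointwise estimate has six terms on its right-hand side. It is raised to the power \<open>p\<close> and
  integrated in \<open>\<xi>\<close>. Three of the terms carry the norm of \<open>x - z\<close>; together they contribute
  \<open>L\<^sub>*\<close> times the integral on the left, and are absorbed there.\<close>

lemma trajectory_difference_integrated:
  fixes \<Omega> E :: "(real^'k) set"
    and K2 :: "real^'k \<Rightarrow> real^'k \<Rightarrow> real^'n \<Rightarrow> real^'m^'n"
    and u v :: "real^'k \<Rightarrow> real^'m" and x z :: "real^'k \<Rightarrow> real^'n"
  assumes pq: "p > 1" "q > 1" "1 / p + 1 / q = 1" and lam: "lam \<ge> 0" and r: "r > 0"
    and \<Omega>: "compact \<Omega>" and E: "E \<in> sets lebesgue" "E \<subseteq> \<Omega>"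
    and A: "cond_A \<Omega> p f \<gamma>0" and B: "cond_B \<Omega> p q K1 \<gamma>1" and C: "cond_C \<Omega> p K2 \<gamma>2"
    and u: "u \<in> controls \<Omega> q r" and v: "v \<in> controls \<Omega> q r"
    and uv: "\<And>s. s \<notin> E \<Longrightarrow> u s = v s"
    and x: "trajectory \<Omega> p f K1 K2 lam u x" and z: "trajectory \<Omega> p f K1 K2 lam v z"
    and M: "M \<ge> 0" "\<And>\<xi> s. \<xi> \<in> \<Omega> \<Longrightarrow> s \<in> \<Omega> \<Longrightarrow> norm (g \<xi> s) \<le> M"
    and gp: "AE \<xi> in lebesgue_on \<Omega>. integrable (lebesgue_on \<Omega>) (\<lambda>s. norm (K2 \<xi> s 0 - g \<xi> s) powr p)"
    and gpp: "integrable (lebesgue_on \<Omega>) (\<lambda>\<xi>. \<integral>s. norm (K2 \<xi> s 0 - g \<xi> s) powr p \<partial>lebesgue_on \<Omega>)"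
  shows "(1 - L_star \<Omega> p q r \<gamma>0 \<gamma>1 \<gamma>2 lam) * (\<integral>\<xi>. norm (x \<xi> - z \<xi>) powr p \<partial>lebesgue_on \<Omega>)
    \<le> 6 powr (p - 1) * (2 * lam * r) powr p *
      (kappa2 \<Omega> \<gamma>2 powr p * (\<integral>s. indicator E s * norm (x s) powr p \<partial>lebesgue_on \<Omega>) * measure lebesgue \<Omega>
       + (\<integral>\<xi>. (\<integral>s. norm (K2 \<xi> s 0 - g \<xi> s) powr p \<partial>lebesgue_on \<Omega>) \<partial>lebesgue_on \<Omega>)
       + M powr p * measure lebesgue E * measure lebesgue \<Omega>)"
proof -
  let ?N = "lebesgue_on \<Omega>"
  define w where "w \<xi> = norm (x \<xi> - z \<xi>)" for \<xi>
  define G where "G \<xi> = (\<integral>s. \<gamma>1 \<xi> s powr q \<partial>?N)" for \<xi>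
  define H where "H \<xi> = (\<integral>s. norm (K2 \<xi> s 0 - g \<xi> s) powr p \<partial>?N)" for \<xi>
  define W where "W = (\<integral>\<xi>. w \<xi> powr p \<partial>?N)"
  define X where "X = (\<integral>s. indicator E s * norm (x s) powr p \<partial>?N)"
  define a0 where "a0 = kappa0 \<Omega> \<gamma>0"
  define a2 where "a2 = kappa2 \<Omega> \<gamma>2"
  define \<mu> where "\<mu> = measure lebesgue \<Omega>"
  define \<nu> where "\<nu> = measure lebesgue E"
  have a0: "a0 \<ge> 0" and a2: "a2 \<ge> 0"
    by (simp_all add: a0_def a2_def kappa0_def kappa2_def Linf_norm_def)
  have w0: "w \<xi> \<ge> 0" and G0: "G \<xi> \<ge> 0" and H0: "H \<xi> \<ge> 0" for \<xi>
    by (simp_all add: w_def G_def H_def)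
  have W0: "W \<ge> 0" and X0: "X \<ge> 0" and \<nu>0: "\<nu> \<ge> 0"
    by (simp_all add: W_def X_def \<nu>_def)
  have W_root: "Lp_norm p \<Omega> (\<lambda>s. x s - z s) = W powr (1 / p)"
    by (simp add: Lp_norm_def W_def w_def)
  have root: "(t powr (1 / p)) powr p = t" if "t \<ge> 0" for t :: real
    using that pq by (simp add: powr_powr)
  have Groot: "(G \<xi> powr (1 / q)) powr p = G \<xi> powr (p / q)" for \<xi>
    by (simp add: powr_powr)
  define R where "R \<xi> = 6 powr (p - 1) * (a0 powr p * w \<xi> powr p
      + lam powr p * W * G \<xi> powr (p / q) + lam powr p * r powr p * a2 powr p * W
      + (2 * lam * r) powr p * (a2 powr p * X) + (2 * lam * r) powr p * H \<xi>
      + (2 * lam * r) powr p * (M powr p * \<nu>))" for \<xi>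
  have "AE \<xi> in ?N. w \<xi> \<le> a0 * w \<xi> + lam * (G \<xi> powr (1 / q) * W powr (1 / p)
      + a2 * r * W powr (1 / p) + 2 * r * (a2 * X powr (1 / p) + H \<xi> powr (1 / p) + M * \<nu> powr (1 / p)))"
    unfolding W_root[symmetric] w_def G_def H_def X_def a0_def a2_def \<nu>_def
    by (rule trajectory_difference_pointwise[OF pq lam \<Omega> E A B C u v uv x z M gp])
  then have "AE \<xi> in ?N. w \<xi> powr p \<le> R \<xi>"
  proof eventually_elim
    case (elim \<xi>)
    have "w \<xi> \<le> a0 * w \<xi> + lam * (G \<xi> powr (1 / q) * W powr (1 / p))
        + lam * r * a2 * W powr (1 / p) + (2 * lam * r) * (a2 * X powr (1 / p))
        + (2 * lam * r) * H \<xi> powr (1 / p) + (2 * lam * r) * (M * \<nu> powr (1 / p))"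
      using elim by (simp add: algebra_simps)
    then have "w \<xi> powr p \<le> 6 powr (p - 1) * ((a0 * w \<xi>) powr p
        + (lam * (G \<xi> powr (1 / q) * W powr (1 / p))) powr p
        + (lam * r * a2 * W powr (1 / p)) powr p + ((2 * lam * r) * (a2 * X powr (1 / p))) powr p
        + ((2 * lam * r) * H \<xi> powr (1 / p)) powr p + ((2 * lam * r) * (M * \<nu> powr (1 / p))) powr p)"
      using a0 a2 w0 lam r M(1) by (intro powr_le_six_terms pq) auto
    also have "\<dots> = R \<xi>"
      using a0 a2 w0[of \<xi>] G0[of \<xi>] H0[of \<xi>] W0 X0 \<nu>0 lam r M(1)
      by (simp add: R_def powr_mult root Groot mult_ac)
    finally show ?case .
  qed
  moreover have wp: "integrable ?N (\<lambda>\<xi>. w \<xi> powr p)"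
    using Lp_space_diff[OF pq(1), of x \<Omega> z] x z by (simp add: trajectory_def Lp_space_def w_def)
  moreover have Gp: "integrable ?N (\<lambda>\<xi>. G \<xi> powr (p / q))"
    using B by (simp add: cond_B_def G_def)
  moreover have Hp: "integrable ?N H"
    using gpp by (simp add: H_def[abs_def])
  have fin: "finite_measure ?N"
    using \<Omega> by (intro finite_measure_lebesgue_on lmeasurable_compact)
  then have const: "integrable ?N (\<lambda>\<xi>. t)" for t :: real
    by (rule finite_measure.integrable_const)
  have space: "measure ?N (space ?N) = \<mu>"
    using \<Omega> by (simp add: \<mu>_def measure_restrict_space borel_compact)
  have Rp: "integrable ?N R"
    unfolding R_def by (intro integrable_mult_right Bochner_Integration.integrable_add wp Gp Hp const)
  ultimately have "W \<le> (\<integral>\<xi>. R \<xi> \<partial>?N)"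
    unfolding W_def by (intro integral_mono_AE wp Rp)
  also have "\<dots> = 6 powr (p - 1) * (a0 powr p * W
      + lam powr p * W * (\<integral>\<xi>. G \<xi> powr (p / q) \<partial>?N) + lam powr p * r powr p * a2 powr p * W * \<mu>
      + (2 * lam * r) powr p * (a2 powr p * X) * \<mu> + (2 * lam * r) powr p * (\<integral>\<xi>. H \<xi> \<partial>?N)
      + (2 * lam * r) powr p * (M powr p * \<nu>) * \<mu>)"
    unfolding R_def using wp Gp Hp const space by (simp add: W_def)
  also have "(\<integral>\<xi>. G \<xi> powr (p / q) \<partial>?N) = kappa1 \<Omega> p q \<gamma>1 powr p"
    by (simp add: kappa1_def G_def root)
  finally show ?thesis
    unfolding L_star_def W_def[unfolded w_def, symmetric] X_def[symmetric] H_def[symmetric]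
      a0_def[symmetric] a2_def[symmetric] \<mu>_def[symmetric] \<nu>_def[symmetric]
    by (simp add: algebra_simps)
qed

text \<open>Without the integral term the controls have no influence: both trajectories are fixed points of
  the contraction \<open>f \<xi>\<close>. This case is separate because \<open>c\<^sub>*\<close> vanishes in it, and quotients by
  powers of \<open>c\<^sub>*\<close> are infinite and give no information about \<open>g\<close>.\<close>

lemma trajectory_unique_lam_zero:
  assumes p: "p > 1" and A: "cond_A \<Omega> p f \<gamma>0" and L: "L_star \<Omega> p q r \<gamma>0 \<gamma>1 \<gamma>2 0 < 1"
    and x: "trajectory \<Omega> p f K1 K2 0 u x" and z: "trajectory \<Omega> p f K1 K2 0 v z"
  shows "AE \<xi> in lebesgue_on \<Omega>. x \<xi> = z \<xi>"
proof -
  let ?\<kappa> = "kappa0 \<Omega> \<gamma>0"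
  have \<kappa>0: "?\<kappa> \<ge> 0"
    by (simp add: kappa0_def Linf_norm_def)
  have "?\<kappa> powr p \<le> 6 powr (p - 1) * ?\<kappa> powr p"
    using p ge_one_powr_ge_zero[of 6 "p - 1"] by (simp add: mult_le_cancel_right1)
  also have "\<dots> < 1"
    using L p by (simp add: L_star_def)
  finally have "?\<kappa> < 1"
    using ge_one_powr_ge_zero[of ?\<kappa> p] p by linarith
  have "AE \<xi> in lebesgue_on \<Omega>. x \<xi> = f \<xi> (x \<xi>)" "AE \<xi> in lebesgue_on \<Omega>. z \<xi> = f \<xi> (z \<xi>)"
    using x z by (auto simp: trajectory_def elim: eventually_mono)
  then show ?thesis
    using cond_A_kappa0[OF A]
  proof eventually_elim
    case (elim \<xi>)
    have "norm (x \<xi> - z \<xi>) \<le> ?\<kappa> * norm (x \<xi> - z \<xi>)"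
      using elim by metis
    then have "(1 - ?\<kappa>) * norm (x \<xi> - z \<xi>) \<le> 0"
      by (simp add: algebra_simps)
    then have "norm (x \<xi> - z \<xi>) \<le> 0"
      using \<open>?\<kappa> < 1\<close> by (simp add: mult_le_0_iff)
    then show ?case
      by simp
  qed
qed

section \<open>Replacing a control on a small set\<close>

lemma nn_integral_lebesgue_on_subset:
  fixes f :: "'a::euclidean_space \<Rightarrow> real"
  assumes \<Omega>: "\<Omega> \<in> sets lebesgue" and E: "E \<in> sets lebesgue" "E \<subseteq> \<Omega>"
    and f: "integrable (lebesgue_on \<Omega>) f" "\<And>s. f s \<ge> 0"
  shows "(\<integral>\<^sup>+s. ennreal (f s) \<partial>lebesgue_on E) = ennreal (\<integral>s. indicator E s * f s \<partial>lebesgue_on \<Omega>)"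
proof -
  have "E \<in> sets (lebesgue_on \<Omega>)"
    using E \<Omega> by (simp add: sets_restrict_space_iff)
  then have int: "integrable (lebesgue_on \<Omega>) (\<lambda>s. indicator E s * f s)"
    using integrable_mult_indicator[OF _ f(1)] by simp
  have "(\<integral>\<^sup>+s. ennreal (f s) \<partial>lebesgue_on E) = (\<integral>\<^sup>+s. ennreal (f s) * indicator E s \<partial>lebesgue)"
    using E by (simp add: nn_integral_restrict_space)
  also have "\<dots> = (\<integral>\<^sup>+s. ennreal (indicator E s * f s) * indicator \<Omega> s \<partial>lebesgue)"
    using E by (intro nn_integral_cong) (auto simp: indicator_def)
  also have "\<dots> = (\<integral>\<^sup>+s. ennreal (indicator E s * f s) \<partial>lebesgue_on \<Omega>)"
    using \<Omega> by (simp add: nn_integral_restrict_space)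
  also have "\<dots> = ennreal (\<integral>s. indicator E s * f s \<partial>lebesgue_on \<Omega>)"
    using f(2) by (intro nn_integral_eq_integral int) auto
  finally show ?thesis .
qed

text \<open>Turns the smallness conditions, quotients in \<^typ>\<open>ennreal\<close>, into real inequalities. For \<open>a = 0\<close>
  the quotient is infinite and the hypothesis is void, but then the left-hand side is zero.\<close>

lemma ennreal_le_divide_cancel:
  fixes t e a d m :: real
  assumes "ennreal t \<le> ennreal e / ennreal (3 * a * d * m)"
    and "e > 0" "a \<ge> 0" "d > 0" "m > 0"
  shows "a * t * m \<le> e / (3 * d)"
proof (cases "a = 0")
  case True
  then show ?thesis
    using assms by simp
next
  case False
  then have a: "a > 0"
    using assms by simp
  then have "ennreal e / ennreal (3 * a * d * m) = ennreal (e / (3 * a * d * m))"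
    using assms by (intro divide_ennreal) auto
  then have "t \<le> e / (3 * a * d * m)"
    using assms a by (metis divide_nonneg_nonneg ennreal_le_iff less_imp_le mult_nonneg_nonneg zero_le_numeral)
  then show ?thesis
    using assms a by (simp add: field_simps)
qed

theorem theorem3p1:
  fixes \<Omega> \<Omega>s :: "(real^'k) set"
    and p q r lam \<epsilon> \<delta> r0 :: real
    and f :: "real^'k \<Rightarrow> real^'n \<Rightarrow> real^'n"
    and K1 :: "real^'k \<Rightarrow> real^'k \<Rightarrow> real^'n \<Rightarrow> real^'n"
    and K2 :: "real^'k \<Rightarrow> real^'k \<Rightarrow> real^'n \<Rightarrow> real^'m^'n"
    and \<gamma>0 :: "real^'k \<Rightarrow> real"
    and \<gamma>1 \<gamma>2 :: "real^'k \<Rightarrow> real^'k \<Rightarrow> real"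
    and g :: "real^'k \<Rightarrow> real^'k \<Rightarrow> real^'m^'n"
    and u us v :: "real^'k \<Rightarrow> real^'m"
    and x z :: "real^'k \<Rightarrow> real^'n"
  assumes "compact \<Omega>" and "lam \<ge> 0" and "r > 0"
    and "q > 1" and "p > 1" and "1 / p + 1 / q = 1"
    and "cond_A \<Omega> p f \<gamma>0" and "cond_B \<Omega> p q K1 \<gamma>1" and "cond_C \<Omega> p K2 \<gamma>2"
    and "L_star \<Omega> p q r \<gamma>0 \<gamma>1 \<gamma>2 lam < 1"
    and "\<epsilon> > 0"
    and "kernel_approx \<Omega> p K2 (c_star \<Omega> p q r \<gamma>0 \<gamma>1 \<gamma>2 lam) \<epsilon> g"
    and "admissible_delta \<Omega> p (trajectories \<Omega> p q r f K1 K2 lam) (kappa2 \<Omega> \<gamma>2)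
           (c_star \<Omega> p q r \<gamma>0 \<gamma>1 \<gamma>2 lam) (max_norm \<Omega> g) \<epsilon> \<delta>"
    and "u \<in> controls \<Omega> q r" and "Lp_norm q \<Omega> u = r0" and "r0 < r"
    and "trajectory \<Omega> p f K1 K2 lam u x"
    and "\<Omega>s \<in> sets lebesgue" and "\<Omega>s \<subseteq> \<Omega>"
    and "us \<in> borel_measurable (lebesgue_on \<Omega>s)"
    and "v = (\<lambda>\<xi>. if \<xi> \<in> \<Omega>s then us \<xi> else u \<xi>)"
    and "v \<in> controls \<Omega> q r" and "Lp_norm q \<Omega> v = r"
    and "trajectory \<Omega> p f K1 K2 lam v z"
    and "measure lebesgue \<Omega>s \<le> \<delta>"
  shows "Lp_norm p \<Omega> (\<lambda>\<xi>. x \<xi> - z \<xi>) \<le> \<epsilon>"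
proof -
  note \<Omega> = \<open>compact \<Omega>\<close> and p = \<open>p > 1\<close> and r = \<open>r > 0\<close> and \<epsilon> = \<open>\<epsilon> > 0\<close>
    and C = \<open>cond_C \<Omega> p K2 \<gamma>2\<close>
    and tx = \<open>trajectory \<Omega> p f K1 K2 lam u x\<close>
  let ?N = "lebesgue_on \<Omega>"
  let ?L = "L_star \<Omega> p q r \<gamma>0 \<gamma>1 \<gamma>2 lam"
  define c where "c = c_star \<Omega> p q r \<gamma>0 \<gamma>1 \<gamma>2 lam"
  define M where "M = max_norm \<Omega> g"
  define \<kappa> where "\<kappa> = kappa2 \<Omega> \<gamma>2"
  define \<mu> where "\<mu> = measure lebesgue \<Omega>"
  have \<Omega>b: "\<Omega> \<in> sets borel"
    using \<Omega> by (simp add: borel_compact)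
  then have \<Omega>l: "\<Omega> \<in> sets lebesgue"
    by simp
  have finite: "emeasure lebesgue \<Omega> \<noteq> top"
    by (rule fmeasurableD2[OF lmeasurable_compact[OF \<Omega>]])
  consider "lam = 0" | "\<mu> = 0" | "lam > 0" "\<mu> > 0"
    using \<open>lam \<ge> 0\<close> unfolding \<mu>_def by (metis less_eq_real_def measure_nonneg)
  then show ?thesis
  proof cases
    case 1
    then have "AE \<xi> in ?N. x \<xi> = z \<xi>"
      using assms by (intro trajectory_unique_lam_zero[where f = f]) auto
    then show ?thesis
      using \<epsilon> by (simp add: Lp_norm_diff_eq_0)
  next
    case 2
    then have "\<Omega> \<in> null_sets lebesgue"
      using \<Omega>l emeasure_eq_ennreal_measure[OF finite]
      by (intro null_setsI) (simp_all only: \<mu>_def ennreal_0)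
    then have "AE \<xi> in ?N. x \<xi> = z \<xi>"
      using \<Omega>l by (auto simp: AE_restrict_space_iff dest: AE_not_in elim: eventually_mono)
    then show ?thesis
      using \<epsilon> by (simp add: Lp_norm_diff_eq_0)
  next
    case 3
    define Q where "Q = 6 powr (p - 1) * (2 * lam * r) powr p"
    have L: "1 - ?L > 0"
      using \<open>?L < 1\<close> by simp
    have Q: "Q > 0"
      using 3 r by (simp add: Q_def)
    \<comment> \<open>\<open>c\<^sub>*\<close> is chosen so that its power is the factor of the error terms divided by \<open>1 - L\<^sub>*\<close>.\<close>
    have cp: "c powr p = Q / (1 - ?L)"
      using 3 r L p by (simp add: c_def c_star_def Q_def powr_mult powr_powr)
    then have cp0: "c powr p > 0"
      using Q L by simp
    have "\<Omega> \<noteq> {}"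
      using 3 by (auto simp: \<mu>_def)
    then obtain \<xi>0 where \<xi>0: "\<xi>0 \<in> \<Omega>"
      by blast
    have gcont: "continuous_on (\<Omega> \<times> \<Omega>) (\<lambda>(\<xi>, s). g \<xi> s)"
      and gapprox: "(\<integral>\<^sup>+\<xi>. (\<integral>\<^sup>+s. ennreal (norm (K2 \<xi> s 0 - g \<xi> s) powr p) \<partial>?N) \<partial>?N)
        \<le> ennreal (\<epsilon> powr p) / ennreal (3 * c powr p)"
      using \<open>kernel_approx \<Omega> p K2 (c_star \<Omega> p q r \<gamma>0 \<gamma>1 \<gamma>2 lam) \<epsilon> g\<close>
      by (simp_all add: kernel_approx_def c_def)
    have gM: "norm (g \<xi> s) \<le> M" if "\<xi> \<in> \<Omega>" "s \<in> \<Omega>" for \<xi> s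
      unfolding M_def by (rule norm_le_max_norm[OF \<Omega> gcont that])
    have M0: "M \<ge> 0"
      using gM[OF \<xi>0 \<xi>0] norm_ge_zero order_trans by blast
    have \<delta>: "ennreal \<delta> < ennreal (\<epsilon> powr p) / ennreal (3 * M powr p * c powr p * \<mu>)"
      and X: "(\<integral>\<^sup>+s. ennreal (norm (x s) powr p) \<partial>lebesgue_on \<Omega>s)
        \<le> ennreal (\<epsilon> powr p) / ennreal (3 * \<kappa> powr p * c powr p * \<mu>)"
      using \<open>admissible_delta _ _ _ _ _ _ _ _\<close> \<open>\<Omega>s \<in> sets lebesgue\<close> \<open>\<Omega>s \<subseteq> \<Omega>\<close>
        \<open>measure lebesgue \<Omega>s \<le> \<delta>\<close> tx \<open>u \<in> controls \<Omega> q r\<close>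
      unfolding admissible_delta_def trajectories_def c_def M_def \<kappa>_def \<mu>_def by blast+
    have small_M: "M powr p * measure lebesgue \<Omega>s * \<mu> \<le> \<epsilon> powr p / (3 * c powr p)"
    proof (rule ennreal_le_divide_cancel)
      show "ennreal (measure lebesgue \<Omega>s) \<le> ennreal (\<epsilon> powr p) / ennreal (3 * M powr p * c powr p * \<mu>)"
        using \<delta> ennreal_leI[OF \<open>measure lebesgue \<Omega>s \<le> \<delta>\<close>] by (rule order_trans[rotated, OF less_imp_le])
    qed (use \<epsilon> cp0 3 in auto)
    have xp: "integrable ?N (\<lambda>s. norm (x s) powr p)"
      using tx by (simp add: trajectory_def Lp_space_def)
    have small_x: "\<kappa> powr p * (\<integral>s. indicator \<Omega>s s * norm (x s) powr p \<partial>?N) * \<mu> \<le> \<epsilon> powr p / (3 * c powr p)"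
    proof (rule ennreal_le_divide_cancel)
      show "ennreal (\<integral>s. indicator \<Omega>s s * norm (x s) powr p \<partial>?N)
          \<le> ennreal (\<epsilon> powr p) / ennreal (3 * \<kappa> powr p * c powr p * \<mu>)"
        using X nn_integral_lebesgue_on_subset[OF \<Omega>l \<open>\<Omega>s \<in> sets lebesgue\<close> \<open>\<Omega>s \<subseteq> \<Omega>\<close> xp] by simp
    qed (use \<epsilon> cp0 3 in auto)
    have "(\<lambda>(\<xi>, s). g \<xi> s) \<in> borel_measurable (lebesgue_on (\<Omega> \<times> \<Omega>))"
      using \<Omega> by (intro continuous_imp_measurable_on_sets_lebesgue gcont)
        (simp add: borel_compact compact_Times)
    moreover have "(\<lambda>(\<xi>, s). K2 \<xi> s 0) \<in> borel_measurable (lebesgue_on (\<Omega> \<times> \<Omega>))"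
      using C by (simp add: cond_C_def)
    ultimately have "(\<lambda>y. norm ((\<lambda>(\<xi>, s). K2 \<xi> s 0) y - (\<lambda>(\<xi>, s). g \<xi> s) y) powr p)
        \<in> borel_measurable (lebesgue_on (\<Omega> \<times> \<Omega>))"
      by measurable
    then have Km: "(\<lambda>(\<xi>, s). norm (K2 \<xi> s 0 - g \<xi> s) powr p) \<in> borel_measurable (lebesgue_on (\<Omega> \<times> \<Omega>))"
      by (simp add: case_prod_beta')
    have "ennreal (\<epsilon> powr p) / ennreal (3 * c powr p) = ennreal (\<epsilon> powr p / (3 * c powr p))"
      using cp0 by (intro divide_ennreal) auto
    then have K: "(\<integral>\<^sup>+\<xi>. (\<integral>\<^sup>+s. ennreal (norm (K2 \<xi> s 0 - g \<xi> s) powr p) \<partial>?N) \<partial>?N)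
        \<le> ennreal (\<epsilon> powr p / (3 * c powr p))"
      using gapprox by simp
    \<comment> \<open>The bounds in \<open>small_M\<close>, \<open>small_x\<close> and \<open>K\<close> are equal; each is a third of what is needed below.\<close>
    note K_int = lebesgue_on_iterated_integral[OF \<Omega>b \<Omega>b Km _ K]
    have "(1 - ?L) * (\<integral>\<xi>. norm (x \<xi> - z \<xi>) powr p \<partial>?N)
        \<le> Q * (\<kappa> powr p * (\<integral>s. indicator \<Omega>s s * norm (x s) powr p \<partial>?N) * \<mu>
          + (\<integral>\<xi>. (\<integral>s. norm (K2 \<xi> s 0 - g \<xi> s) powr p \<partial>?N) \<partial>?N)
          + M powr p * measure lebesgue \<Omega>s * \<mu>)"
      unfolding Q_def \<kappa>_def \<mu>_def
      by (rule trajectory_difference_integrated[where f = f and u = u and v = v])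
        (use assms gM M0 K_int cp0 in auto)
    also have "\<dots> \<le> Q * (\<epsilon> powr p / (3 * c powr p) + \<epsilon> powr p / (3 * c powr p) + \<epsilon> powr p / (3 * c powr p))"
      using Q cp0 by (intro mult_left_mono add_mono small_x small_M K_int(3)) auto
    also have "\<dots> = (1 - ?L) * \<epsilon> powr p"
      using Q L by (simp add: cp field_simps)
    finally have "(\<integral>\<xi>. norm (x \<xi> - z \<xi>) powr p \<partial>?N) \<le> \<epsilon> powr p"
      using L by (simp add: mult_le_cancel_left_pos)
    then have "Lp_norm p \<Omega> (\<lambda>\<xi>. x \<xi> - z \<xi>) \<le> (\<epsilon> powr p) powr (1 / p)"
      unfolding Lp_norm_def using p by (intro powr_mono2) auto
    also have "\<dots> = \<epsilon>"
      using \<epsilon> p by (simp add: powr_powr)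
    finally show ?thesis .
  qed
qed

end
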